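(* Assume the standing assumptions on $\Omega_1,\Omega_2,\mathcal H$ and on $(f_i,l_i)$, $i\in\{1,2,\mathcal H\}$, recalled in the context. Let $(x^0,t^0;x^f,t^f)\in\Omega_1\times\mathbb R^+_*\times\Omega_2\times\mathbb R^+_*$ be such that the infimum defining $S_{1,\mathcal H,2}(x^0,t^0;x^f,t^f)$ is attained, i.e. there exists an optimal trajectory with structure $1$-$\mathcal H$-$2$. Then $$S_{1,\mathcal H,2}(x^0,t^0;x^f,t^f)=\min\Big\{\Sigma(Z_0,T_0;Z_1,T_1)\ :\ (Z_0,Z_1)\in\mathcal M(x^0,t^0;x^f,t^f),\ 0\le T_0<T_1\Big\},$$ where $S_{1,\mathcal H,2}$ is the value function of the regional problem restricted to structure $1$-$\mathcal H$-$2$, $\Sigma$ is the value function of the duplicated problem, and $\mathcal M(x^0,t^0;x^f,t^f)$ is the set of pairs of endpoints defined in the context.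
   Context: Notation: $\mathbb R^+=[0,\infty)$, $\mathbb R^+_*=(0,\infty)$; $N,m\ge1$ are integers. Geometry. $\mathbb R^N=\Omega_1\cup\Omega_2\cup\mathcal H$ with $\Omega_1,\Omega_2$ open, $\Omega_1\cap\Omega_2=\emptyset$, $\mathcal H=\partial\Omega_1=\partial\Omega_2$, and there is a $C^1$ function $\Psi:\mathbb R^N\to\mathbb R$ with $\mathcal H=\{x:\Psi(x)=0\}$ and $\nabla\Psi\neq0$ on $\mathcal H$. Dynamics and costs. $A_1,A_2,A_{\mathcal H}$ are measurable subsets of $\mathbb R^m$. The maps $f_i:\Omega_i\times A_i\to\mathbb R^N$, $l_i:\Omega_i\times A_i\to\mathbb R$ ($i=1,2$), and $f_{\mathcal H}:\mathcal H\times A_{\mathcal H}\to\mathbb R^N$ with $f_{\mathcal H}(x,a)\in T_x\mathcal H$, $l_{\mathcal H}:\mathcal H\times A_{\mathcal H}\to\mathbb R$, are continuous, bounded, $C^1$ in the state variable, and Lipschitz in the state variable together with their first-order state derivatives, with constants uniform in the control. ($f_i,l_i$ are extended by continuity to $\overline\Omega_i$.) Regional problem with structure $1$-$\mathcal H$-$2$. An admissible trajectory from $(x^0,t^0)$ to $(x^f,t^f)$ consists of times $t^0<t_1<t_2<t^f$, controls $\alpha_1\in L^\infty((t^0,t_1);A_1)$, $a_{\mathcal H}\in L^\infty((t_1,t_2);A_{\mathcal H})$, $\alpha_2\in L^\infty((t_2,t^f);A_2)$ and Lipschitz arcs $X_1,X_{\mathcal H},X_2$ on $[t^0,t_1],[t_1,t_2],[t_2,t^f]$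 with $\dot X_1=f_1(X_1,\alpha_1)$, $\dot X_{\mathcal H}=f_{\mathcal H}(X_{\mathcal H},a_{\mathcal H})$, $\dot X_2=f_2(X_2,\alpha_2)$ a.e., $X_1(t^0)=x^0$, $X_1(t_1)=X_{\mathcal H}(t_1)\in\mathcal H$, $X_{\mathcal H}(t_2)=X_2(t_2)\in\mathcal H$, $X_2(t^f)=x^f$, and $X_1\in\Omega_1$ on $(t^0,t_1)$, $X_{\mathcal H}\in\mathcal H$ on $(t_1,t_2)$, $X_2\in\Omega_2$ on $(t_2,t^f)$. Its cost is $\int_{t^0}^{t_1}l_1(X_1,\alpha_1)dt+\int_{t_1}^{t_2}l_{\mathcal H}(X_{\mathcal H},a_{\mathcal H})dt+\int_{t_2}^{t^f}l_2(X_2,\alpha_2)dt$, and $S_{1,\mathcal H,2}(x^0,t^0;x^f,t^f)$ is the infimum of the cost over all admissible trajectories (with $t_1,t_2$ free). Duplicated problem. Fix $T>0$ (large enough) and let $V=(A_1\times[0,T])\times(A_{\mathcal H}\times[0,T])\times(A_2\times[0,T])$. For $T_0<T_1$ and $Z_0,Z_1\in\overline\Omega_1\times\mathbb R^+_*\times\mathcal H\times\mathbb R^+_*\times\overline\Omega_2\times\mathbb R^+_*$, let $\mathcal Z_{(Z_0,T_0),(Z_1,T_1)}$ be the set of Lipschitz $\mathbb Z=(Y_1,\rho_1,Y_{\mathcal H},\rho_{\mathcal H},Y_2,\rho_2):(T_0,T_1)\to\Omega_1\times\mathbb R^+_*\times\mathcal H\times\mathbb R^+_*\times\Omega_2\times\mathbb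 R^+_*$ for which there is a control $(v_1,w_1,v_{\mathcal H},w_{\mathcal H},v_2,w_2)\in L^\infty([T_0,T_1];V)$ with $Y_i'=f_i(Y_i,v_i)w_i$, $\rho_i'=w_i$ a.e. for $i\in\{1,\mathcal H,2\}$, and $\mathbb Z(T_0)=Z_0$, $\mathbb Z(T_1)=Z_1$ (continuous extension). The cost is $\mathcal C(\mathbb Z)=\int_{T_0}^{T_1}\big(l_1(Y_1,v_1)w_1+l_{\mathcal H}(Y_{\mathcal H},v_{\mathcal H})w_{\mathcal H}+l_2(Y_2,v_2)w_2\big)d\tau$ and $\Sigma(Z_0,T_0;Z_1,T_1)=\inf\{\mathcal C(\mathbb Z):\mathbb Z\in\mathcal Z_{(Z_0,T_0),(Z_1,T_1)}\}$ (with $\inf\emptyset=+\infty$). Junction set. $\mathcal M(x^0,t^0;x^f,t^f)$ is the set of pairs $(Z_0,Z_1)$ with $Z_0=(x^0,t^0,x_1,t_1,x_2,t_2)$, $Z_1=(x_1,t_1,x_2,t_2,x^f,t^f)$, where $x_1,x_2\in\mathcal H$ and $t^f>t_2>t_1>t^0$. *)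

theory Defs
  imports "HOL-Analysis.Analysis"
begin

(* One of the three regimes (Omega_1, H or Omega_2): its state region, its control set, its
   dynamics f and its running cost l.  For the two open regions the values of f and l on the
   boundary are those of the continuous extension, see regular_in_state. *)
record ('x, 'a) stratum =
  region :: "'x set"
  controls :: "'a set"
  dyn :: "'x \<Rightarrow> 'a \<Rightarrow> 'x"
  running_cost :: "'x \<Rightarrow> 'a \<Rightarrow> real"

definition regional_geometry ::
  "'x::euclidean_space set \<Rightarrow> 'x set \<Rightarrow> 'x set \<Rightarrow> ('x \<Rightarrow> real) \<Rightarrow> ('x \<Rightarrow> 'x) \<Rightarrow> bool"
where
  "regional_geometry \<Omega>1 \<Omega>2 \<H> \<Psi> grad\<Psi> \<longleftrightarrow>
     \<Omega>1 \<union> \<Omega>2 \<union> \<H> = UNIV \<and> open \<Omega>1 \<and> open \<Omega>2 \<and> \<Omega>1 \<inter> \<Omega>2 = {} \<and>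
     \<H> = frontier \<Omega>1 \<and> \<H> = frontier \<Omega>2 \<and>
     (\<forall>x. GDERIV \<Psi> x :> grad\<Psi> x) \<and> continuous_on UNIV grad\<Psi> \<and>
     \<H> = {x. \<Psi> x = 0} \<and> (\<forall>x\<in>\<H>. grad\<Psi> x \<noteq> 0)"

definition tangent_space :: "('x::euclidean_space \<Rightarrow> 'x) \<Rightarrow> 'x \<Rightarrow> 'x set" where
  "tangent_space grad\<Psi> x = {v. inner (grad\<Psi> x) v = 0}"

(* Regularity of g = f or g = l on S x A, S being the region and A the control set.

   Continuity is stated on closure S x A: this is the continuous extension of g, which always
   exists because g is Lipschitz in the state uniformly in the control.  For S = H, which is
   closed, it is just continuity on H x A.

   State derivatives are taken within S.  For S open this is the usual derivative.  For S = H
   only the values of Dg x a on the tangent space at x are determined, so Dg is any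
   representative of the tangential derivative (for instance the derivative of an extension of
   g to a neighbourhood of H).  Continuity of Dg in the state is implied by its Lipschitz
   bound. *)
definition regular_in_state ::
  "'x::euclidean_space set \<Rightarrow> 'a::euclidean_space set \<Rightarrow> ('x \<Rightarrow> 'a \<Rightarrow> 'y::euclidean_space) \<Rightarrow> bool"
where
  "regular_in_state S A g \<longleftrightarrow>
     continuous_on (closure S \<times> A) (\<lambda>(x, a). g x a) \<and>
     bounded ((\<lambda>(x, a). g x a) ` (S \<times> A)) \<and>
     (\<exists>L. \<forall>a\<in>A. L-lipschitz_on S (\<lambda>x. g x a)) \<and>
     (\<exists>Dg :: 'x \<Rightarrow> 'a \<Rightarrow> 'x \<Rightarrow>\<^sub>L 'y.
        (\<forall>a\<in>A. \<forall>x\<in>S. ((\<lambda>x. g x a) has_derivative blinfun_apply (Dg x a)) (at x within S)) \<and>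
        (\<exists>L. \<forall>a\<in>A. L-lipschitz_on S (\<lambda>x. Dg x a)))"

definition regular_stratum ::
  "('x::euclidean_space, 'a::euclidean_space) stratum \<Rightarrow> bool" where
  "regular_stratum P \<longleftrightarrow>
     controls P \<in> sets lebesgue \<and>
     regular_in_state (region P) (controls P) (dyn P) \<and>
     regular_in_state (region P) (controls P) (running_cost P)"

definition standing_assumptions ::
  "('x::euclidean_space, 'a::euclidean_space) stratum \<Rightarrow> ('x, 'a) stratum \<Rightarrow> ('x, 'a) stratum \<Rightarrow>
   ('x \<Rightarrow> real) \<Rightarrow> ('x \<Rightarrow> 'x) \<Rightarrow> bool"
where
  "standing_assumptions P1 PH P2 \<Psi> grad\<Psi> \<longleftrightarrow>
     regional_geometry (region P1) (region P2) (region PH) \<Psi> grad\<Psi> \<and>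
     regular_stratum P1 \<and> regular_stratum PH \<and> regular_stratum P2 \<and>
     (\<forall>x\<in>region PH. \<forall>a\<in>controls PH. dyn PH x a \<in> tangent_space grad\<Psi> x)"

definition L_inf :: "real set \<Rightarrow> 'v::euclidean_space set \<Rightarrow> (real \<Rightarrow> 'v) \<Rightarrow> bool" where
  "L_inf I V u \<longleftrightarrow>
     u \<in> borel_measurable (lebesgue_on I) \<and>
     (AE t in lebesgue_on I. u t \<in> V) \<and>
     (\<exists>B. AE t in lebesgue_on I. norm (u t) \<le> B)"

definition controlled_arc ::
  "('x::euclidean_space, 'a::euclidean_space) stratum \<Rightarrow> real \<Rightarrow> real \<Rightarrow>
   (real \<Rightarrow> 'a) \<Rightarrow> (real \<Rightarrow> 'x) \<Rightarrow> bool"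
where
  "controlled_arc P a b \<alpha> X \<longleftrightarrow>
     L_inf {a<..<b} (controls P) \<alpha> \<and>
     (\<exists>L. L-lipschitz_on {a..b} X) \<and>
     (\<forall>t\<in>{a<..<b}. X t \<in> region P) \<and>
     (AE t in lebesgue_on {a<..<b}. (X has_vector_derivative dyn P (X t) (\<alpha> t)) (at t))"

definition arc_cost ::
  "('x::euclidean_space, 'a::euclidean_space) stratum \<Rightarrow> real \<Rightarrow> real \<Rightarrow>
   (real \<Rightarrow> 'a) \<Rightarrow> (real \<Rightarrow> 'x) \<Rightarrow> real"
where
  "arc_cost P a b \<alpha> X = (LINT t:{a<..<b}|lebesgue. running_cost P (X t) (\<alpha> t))"

definition admissible ::
  "('x::euclidean_space, 'a::euclidean_space) stratum \<Rightarrow> ('x, 'a) stratum \<Rightarrow> ('x, 'a) stratum \<Rightarrow>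
   'x \<Rightarrow> real \<Rightarrow> 'x \<Rightarrow> real \<Rightarrow> real \<Rightarrow> real \<Rightarrow>
   (real \<Rightarrow> 'a) \<Rightarrow> (real \<Rightarrow> 'a) \<Rightarrow> (real \<Rightarrow> 'a) \<Rightarrow>
   (real \<Rightarrow> 'x) \<Rightarrow> (real \<Rightarrow> 'x) \<Rightarrow> (real \<Rightarrow> 'x) \<Rightarrow> bool"
where
  "admissible P1 PH P2 x0 t0 xf tf t1 t2 \<alpha>1 aH \<alpha>2 X1 XH X2 \<longleftrightarrow>
     t0 < t1 \<and> t1 < t2 \<and> t2 < tf \<and>
     controlled_arc P1 t0 t1 \<alpha>1 X1 \<and>
     controlled_arc PH t1 t2 aH XH \<and>
     controlled_arc P2 t2 tf \<alpha>2 X2 \<and>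
     X1 t0 = x0 \<and>
     X1 t1 = XH t1 \<and> XH t1 \<in> region PH \<and>
     XH t2 = X2 t2 \<and> X2 t2 \<in> region PH \<and>
     X2 tf = xf"

definition trajectory_cost ::
  "('x::euclidean_space, 'a::euclidean_space) stratum \<Rightarrow> ('x, 'a) stratum \<Rightarrow> ('x, 'a) stratum \<Rightarrow>
   real \<Rightarrow> real \<Rightarrow> real \<Rightarrow> real \<Rightarrow>
   (real \<Rightarrow> 'a) \<Rightarrow> (real \<Rightarrow> 'a) \<Rightarrow> (real \<Rightarrow> 'a) \<Rightarrow>
   (real \<Rightarrow> 'x) \<Rightarrow> (real \<Rightarrow> 'x) \<Rightarrow> (real \<Rightarrow> 'x) \<Rightarrow> real"
where
  "trajectory_cost P1 PH P2 t0 tf t1 t2 \<alpha>1 aH \<alpha>2 X1 XH X2 =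
     arc_cost P1 t0 t1 \<alpha>1 X1 + arc_cost PH t1 t2 aH XH + arc_cost P2 t2 tf \<alpha>2 X2"

(* Value functions are ereal-valued, so that the infimum over the empty set is \<infinity>. *)
definition S_1H2 ::
  "('x::euclidean_space, 'a::euclidean_space) stratum \<Rightarrow> ('x, 'a) stratum \<Rightarrow> ('x, 'a) stratum \<Rightarrow>
   'x \<Rightarrow> real \<Rightarrow> 'x \<Rightarrow> real \<Rightarrow> ereal"
where
  "S_1H2 P1 PH P2 x0 t0 xf tf =
     Inf {ereal (trajectory_cost P1 PH P2 t0 tf t1 t2 \<alpha>1 aH \<alpha>2 X1 XH X2) |
            t1 t2 \<alpha>1 aH \<alpha>2 X1 XH X2.
            admissible P1 PH P2 x0 t0 xf tf t1 t2 \<alpha>1 aH \<alpha>2 X1 XH X2}"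

definition optimal ::
  "('x::euclidean_space, 'a::euclidean_space) stratum \<Rightarrow> ('x, 'a) stratum \<Rightarrow> ('x, 'a) stratum \<Rightarrow>
   'x \<Rightarrow> real \<Rightarrow> 'x \<Rightarrow> real \<Rightarrow> real \<Rightarrow> real \<Rightarrow>
   (real \<Rightarrow> 'a) \<Rightarrow> (real \<Rightarrow> 'a) \<Rightarrow> (real \<Rightarrow> 'a) \<Rightarrow>
   (real \<Rightarrow> 'x) \<Rightarrow> (real \<Rightarrow> 'x) \<Rightarrow> (real \<Rightarrow> 'x) \<Rightarrow> bool"
where
  "optimal P1 PH P2 x0 t0 xf tf t1 t2 \<alpha>1 aH \<alpha>2 X1 XH X2 \<longleftrightarrow>
     admissible P1 PH P2 x0 t0 xf tf t1 t2 \<alpha>1 aH \<alpha>2 X1 XH X2 \<and>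
     ereal (trajectory_cost P1 PH P2 t0 tf t1 t2 \<alpha>1 aH \<alpha>2 X1 XH X2) = S_1H2 P1 PH P2 x0 t0 xf tf"

(* (Y_1, rho_1, Y_H, rho_H, Y_2, rho_2) *)
type_synonym 'x dup_state = "'x \<times> real \<times> 'x \<times> real \<times> 'x \<times> real"

(* ((v_1, w_1), (v_H, w_H), (v_2, w_2)) *)
type_synonym 'a dup_control = "('a \<times> real) \<times> ('a \<times> real) \<times> ('a \<times> real)"

definition dup_states ::
  "('x, 'a) stratum \<Rightarrow> ('x, 'a) stratum \<Rightarrow> ('x, 'a) stratum \<Rightarrow> 'x dup_state set" where
  "dup_states P1 PH P2 =
     region P1 \<times> {0<..} \<times> region PH \<times> {0<..} \<times> region P2 \<times> {0<..}"

definition dup_controls ::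
  "('x, 'a) stratum \<Rightarrow> ('x, 'a) stratum \<Rightarrow> ('x, 'a) stratum \<Rightarrow> real \<Rightarrow> 'a dup_control set" where
  "dup_controls P1 PH P2 T =
     (controls P1 \<times> {0..T}) \<times> (controls PH \<times> {0..T}) \<times> (controls P2 \<times> {0..T})"

fun dup_dyn ::
  "('x::euclidean_space, 'a) stratum \<Rightarrow> ('x, 'a) stratum \<Rightarrow> ('x, 'a) stratum \<Rightarrow>
   'x dup_state \<Rightarrow> 'a dup_control \<Rightarrow> 'x dup_state"
where
  "dup_dyn P1 PH P2 (y1, r1, yH, rH, y2, r2) ((v1, w1), (vH, wH), (v2, w2)) =
     (w1 *\<^sub>R dyn P1 y1 v1, w1, wH *\<^sub>R dyn PH yH vH, wH, w2 *\<^sub>R dyn P2 y2 v2, w2)"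

fun dup_running_cost ::
  "('x, 'a) stratum \<Rightarrow> ('x, 'a) stratum \<Rightarrow> ('x, 'a) stratum \<Rightarrow>
   'x dup_state \<Rightarrow> 'a dup_control \<Rightarrow> real"
where
  "dup_running_cost P1 PH P2 (y1, r1, yH, rH, y2, r2) ((v1, w1), (vH, wH), (v2, w2)) =
     running_cost P1 y1 v1 * w1 + running_cost PH yH vH * wH + running_cost P2 y2 v2 * w2"

(* Only the values of Z on the open interval matter; the endpoint conditions are limits. *)
definition dup_admissible ::
  "('x::euclidean_space, 'a::euclidean_space) stratum \<Rightarrow> ('x, 'a) stratum \<Rightarrow> ('x, 'a) stratum \<Rightarrow>
   real \<Rightarrow> 'x dup_state \<Rightarrow> real \<Rightarrow> 'x dup_state \<Rightarrow> real \<Rightarrow>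
   (real \<Rightarrow> 'a dup_control) \<Rightarrow> (real \<Rightarrow> 'x dup_state) \<Rightarrow> bool"
where
  "dup_admissible P1 PH P2 T Z0 T0 Z1 T1 u Z \<longleftrightarrow>
     L_inf {T0..T1} (dup_controls P1 PH P2 T) u \<and>
     (\<exists>L. L-lipschitz_on {T0<..<T1} Z) \<and>
     (\<forall>\<tau>\<in>{T0<..<T1}. Z \<tau> \<in> dup_states P1 PH P2) \<and>
     (AE \<tau> in lebesgue_on {T0<..<T1}.
        (Z has_vector_derivative dup_dyn P1 PH P2 (Z \<tau>) (u \<tau>)) (at \<tau>)) \<and>
     (Z \<longlongrightarrow> Z0) (at_right T0) \<and> (Z \<longlongrightarrow> Z1) (at_left T1)"

definition dup_cost ::
  "('x::euclidean_space, 'a::euclidean_space) stratum \<Rightarrow> ('x, 'a) stratum \<Rightarrow> ('x, 'a) stratum \<Rightarrow>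
   real \<Rightarrow> real \<Rightarrow> (real \<Rightarrow> 'a dup_control) \<Rightarrow> (real \<Rightarrow> 'x dup_state) \<Rightarrow> real"
where
  "dup_cost P1 PH P2 T0 T1 u Z =
     (LINT \<tau>:{T0<..<T1}|lebesgue. dup_running_cost P1 PH P2 (Z \<tau>) (u \<tau>))"

definition \<Sigma>_dup ::
  "('x::euclidean_space, 'a::euclidean_space) stratum \<Rightarrow> ('x, 'a) stratum \<Rightarrow> ('x, 'a) stratum \<Rightarrow>
   real \<Rightarrow> 'x dup_state \<Rightarrow> real \<Rightarrow> 'x dup_state \<Rightarrow> real \<Rightarrow> ereal"
where
  "\<Sigma>_dup P1 PH P2 T Z0 T0 Z1 T1 =
     Inf {ereal (dup_cost P1 PH P2 T0 T1 u Z) | u Z. dup_admissible P1 PH P2 T Z0 T0 Z1 T1 u Z}"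

definition junctions ::
  "'x set \<Rightarrow> 'x \<Rightarrow> real \<Rightarrow> 'x \<Rightarrow> real \<Rightarrow> ('x dup_state \<times> 'x dup_state) set" where
  "junctions \<H> x0 t0 xf tf =
     {((x0, t0, x1, t1, x2, t2), (x1, t1, x2, t2, xf, tf)) | x1 t1 x2 t2.
        x1 \<in> \<H> \<and> x2 \<in> \<H> \<and> t0 < t1 \<and> t1 < t2 \<and> t2 < tf}"

definition is_minimum_of :: "'b::order \<Rightarrow> 'b set \<Rightarrow> bool" where
  "is_minimum_of m E \<longleftrightarrow> m \<in> E \<and> (\<forall>e\<in>E. m \<le> e)"

end

theory Submission
  imports Defs
begin

text \<open>
A trajectory of the regional problem visits the three regimes one after the other; a trajectory
of the duplicated problem runs one copy of each regime at the same time, over a common parameter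
interval. The clock \<open>\<rho>\<^sub>i\<close> of each copy records how much physical time this copy has used, and its
speed \<open>w\<^sub>i = \<rho>\<^sub>i'\<close> multiplies both dynamics and running cost. Hence, once parametrised by its
own clock, a copy is an ordinary controlled arc with the same cost, and the endpoint conditions
collected in the junction set say exactly that the three arcs obtained in this way can be
concatenated. The two problems thus have the same achievable costs.

From the duplicated to the regional problem, the time change \<open>s = \<rho> \<tau>\<close> must be inverted although
\<open>\<rho>\<close> is merely Lipschitz and nondecreasing, with \<open>w = 0\<close> allowed on a set of positive measure. The
bound \<open>norm (Y y - Y x) \<le> M * (\<rho> y - \<rho> x)\<close> (lemma \<open>clocked_arc_increments\<close>) shows that the position
stands still whenever the clock does, so \<open>X (\<rho> \<tau>) = Y \<tau>\<close> defines a Lipschitz curve \<open>X\<close>. On the set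
\<open>S\<close> of good parameters with \<open>w > 0\<close> the clock is injective, so the control can be transported as
well. What \<open>\<rho>\<close> does outside \<open>S\<close> is invisible: null sets have null images because \<open>\<rho>\<close> is Lipschitz,
and \<open>{w = 0}\<close> has a null image by Sard's theorem. The change-of-variables formula on \<open>S\<close> then
identifies the costs. This is lemma \<open>clocked_arc_unit_speed\<close>, which yields that the regional
value is at most every value of the duplicated problem (\<open>S_1H2_le_dup_cost\<close>).

Conversely, an optimal regional trajectory is turned into an admissible one for the duplicated
problem by running its three arcs at constant speed over the same interval \<open>[0, K]\<close>
(\<open>\<Sigma>_dup_le_trajectory_cost\<close>); for \<open>K = (t\<^sup>f - t\<^sup>0) / T\<close> none of these speeds exceeds \<open>T\<close>. The
rescaled arcs come from the same lemma \<open>clocked_arc_unit_speed\<close>, applied to the regime whose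
dynamics and cost are multiplied by the speed.
\<close>

section \<open>Lipschitz functions of one variable and null sets\<close>

lemma AE_lebesgue_on_iff_negligible:
  fixes S :: "'x::euclidean_space set"
  assumes "S \<in> sets lebesgue"
  shows "(AE x in lebesgue_on S. Q x) \<longleftrightarrow> negligible {x \<in> S. \<not> Q x}"
proof -
  have "(AE x in lebesgue_on S. Q x) \<longleftrightarrow> (AE x in lebesgue. x \<in> S \<longrightarrow> Q x)"
    using assms by (simp add: AE_restrict_space_iff)
  also have "\<dots> \<longleftrightarrow> {x. \<not> (x \<in> S \<longrightarrow> Q x)} \<in> null_sets lebesgue"
    by (auto simp: completion.null_sets_iff_AE)
  also have "\<dots> \<longleftrightarrow> negligible {x \<in> S. \<not> Q x}"
    by (simp add: negligible_iff_null_sets)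
  finally show ?thesis .
qed

lemma lipschitz_on_negligible_image:
  fixes \<phi> :: "real \<Rightarrow> real"
  assumes "L-lipschitz_on D \<phi>" "N \<subseteq> D" "negligible N"
  shows "negligible (\<phi> ` N)"
proof (rule negligible_locally_Lipschitz_image)
  fix x assume "x \<in> N"
  have "norm (\<phi> y - \<phi> x) \<le> L * norm (y - x)" if "y \<in> N" for y
    using lipschitz_on_normD[OF assms(1), of y x] that \<open>x \<in> N\<close> assms(2) by auto
  thus "\<exists>U B. open U \<and> x \<in> U \<and> (\<forall>y\<in>N \<inter> U. norm (\<phi> y - \<phi> x) \<le> B * norm (y - x))"
    by (intro exI[of _ UNIV] exI[of _ L]) auto
qed (use assms in auto)

text \<open>
The one-dimensional case of Sard's theorem, obtained from the version for \<open>real ^ 'n\<close> by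
identifying \<open>real\<close> with \<open>real ^ 1\<close>.
\<close>

lemma sard_real:
  fixes \<phi> :: "real \<Rightarrow> real"
  assumes "\<And>x. x \<in> S \<Longrightarrow> (\<phi> has_real_derivative 0) (at x)"
  shows "negligible (\<phi> ` S)"
proof -
  let ?lift = "vec :: real \<Rightarrow> real^1"
  let ?drop = "(\<lambda>x::real^1. x $ 1)"
  have "negligible ((?lift \<circ> \<phi> \<circ> ?drop) ` (?lift ` S))"
  proof (rule baby_Sard[where f' = "\<lambda>_ _. 0"])
    fix x assume "x \<in> ?lift ` S"
    then obtain z where z: "z \<in> S" "x = vec z" by auto
    have "(\<phi> has_derivative (\<lambda>h. h * 0)) (at z within S)"
      using assms[OF z(1)] by (auto simp: has_field_derivative_def mult_zero_left[abs_def] intro: has_derivative_at_withinI)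
    from has_derivative_vector_1[OF this]
    show "((?lift \<circ> \<phi> \<circ> ?drop) has_derivative (\<lambda>_. 0)) (at x within ?lift ` S)"
      by (simp add: o_def z(2) scaleR_zero_left[abs_def])
    show "rank (matrix (\<lambda>_. 0 :: real^1) :: real^1^1) < CARD(1)"
    proof -
      have "matrix (\<lambda>_. 0 :: real^1) = (0 :: real^1^1)"
        by (simp add: matrix_def vec_eq_iff)
      thus ?thesis by simp
    qed
  qed auto
  moreover have "\<phi> ` S = ?drop ` ((?lift \<circ> \<phi> \<circ> ?drop) ` (?lift ` S))"
    by (force simp: image_iff)
  moreover have "negligible (?drop ` N)" if "negligible N" for N
    by (rule negligible_differentiable_image_negligible[OF _ that])
       (auto simp: differentiable_on_def intro!: bounded_linear_imp_differentiable bounded_linear_vec_nth)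
  ultimately show ?thesis by simp
qed

text \<open>
After adding \<open>\<epsilon> t\<close>, the derivative is strictly positive off \<open>N\<close>. Suppose that the function \<open>\<psi>\<close> so
obtained takes a smaller value at \<open>y\<close> than at \<open>x\<close>. As \<open>\<psi>\<close> is Lipschitz, \<open>\<psi> ` N\<close> is a null set and
misses some level \<open>c\<close> in between; at the last point where \<open>\<psi>\<close> attains \<open>c\<close> the derivative is
positive although \<open>\<psi> < c\<close> afterwards.
\<close>

lemma lipschitz_AE_nonneg_deriv_mono:
  fixes \<phi> :: "real \<Rightarrow> real"
  assumes lip: "L-lipschitz_on {a..b} \<phi>"
    and N: "negligible N"
    and der: "\<And>x. x \<in> {a<..<b} - N \<Longrightarrow> \<exists>d\<ge>0. (\<phi> has_real_derivative d) (at x)"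
    and xy: "a \<le> x" "x \<le> y" "y \<le> b"
  shows "\<phi> x \<le> \<phi> y"
proof (rule field_le_epsilon)
  fix e :: real assume "e > 0"
  define \<epsilon> where "\<epsilon> = e / (y - x + 1)"
  have "\<epsilon> > 0" using \<open>e > 0\<close> xy by (simp add: \<epsilon>_def)
  define \<psi> where "\<psi> t = \<phi> t + \<epsilon> * t" for t
  have lip\<psi>: "(L + \<epsilon>)-lipschitz_on {a..b} \<psi>"
    unfolding \<psi>_def
    by (intro lipschitz_intros lip lipschitz_on_add)
       (use \<open>\<epsilon> > 0\<close> in \<open>auto intro!: lipschitz_onI simp: dist_real_def abs_mult simp flip: right_diff_distrib\<close>)
  have "\<psi> x \<le> \<psi> y"
  proof (rule ccontr)
    assume "\<not> \<psi> x \<le> \<psi> y"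
    hence less: "\<psi> y < \<psi> x" by simp
    have "negligible (\<psi> ` (N \<inter> {a..b}))"
      by (rule lipschitz_on_negligible_image[OF lip\<psi>]) (use N in \<open>auto intro: negligible_Int\<close>)
    moreover have "\<not> negligible {\<psi> y<..<\<psi> x}"
      using less by (metis box_real(1) negligible_interval(2) greaterThanLessThan_empty_iff not_le)
    ultimately obtain c where c: "c \<in> {\<psi> y<..<\<psi> x}" "c \<notin> \<psi> ` (N \<inter> {a..b})"
      by (meson negligible_subset subsetI)
    define K where "K = {t \<in> {x..y}. \<psi> t \<ge> c}"
    have cont: "continuous_on {x..y} \<psi>"
      using lipschitz_on_continuous_on[OF lip\<psi>] by (rule continuous_on_subset) (use xy in auto)
    have "compact K" 
    proof -
      have "closed K" unfolding K_def
        by (intro continuous_on_closed_Collect_le cont) auto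
      moreover have "bounded K" by (rule bounded_subset[of "{x..y}"]) (auto simp: K_def)
      ultimately show ?thesis by (simp add: compact_eq_bounded_closed)
    qed
    moreover have "x \<in> K" using c xy by (auto simp: K_def)
    ultimately obtain s where s: "s \<in> K" "\<And>t. t \<in> K \<Longrightarrow> t \<le> s"
      using compact_attains_sup[of K] by blast
    have "s < y" using s c by (auto simp: K_def less_le)
    have "\<psi> s = c"
    proof (rule ccontr)
      assume "\<psi> s \<noteq> c"
      hence "\<psi> s > c" using s by (auto simp: K_def)
      moreover have "continuous_on {s..y} \<psi>" by (rule continuous_on_subset[OF cont]) (use s in \<open>auto simp: K_def\<close>)
      ultimately obtain t where "s \<le> t" "t \<le> y" "\<psi> t = c"
        using IVT2'[of \<psi> y c s] c \<open>s < y\<close> by auto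
      hence "t \<in> K" using s(1) by (auto simp: K_def)
      hence "t = s" using s(2) \<open>s \<le> t\<close> by force
      thus False using \<open>\<psi> t = c\<close> \<open>\<psi> s \<noteq> c\<close> by simp
    qed
    moreover have "x \<noteq> s" using \<open>\<psi> s = c\<close> c by auto
    ultimately have "s \<in> {a<..<b} - N" using s c \<open>s < y\<close> xy by (auto simp: K_def)
    then obtain d where "d \<ge> 0" "(\<phi> has_real_derivative d) (at s)" using der by blast
    hence "(\<psi> has_real_derivative d + \<epsilon>) (at s)"
      unfolding \<psi>_def by (auto intro!: derivative_eq_intros)
    from DERIV_pos_inc_right[OF this] \<open>d \<ge> 0\<close> \<open>\<epsilon> > 0\<close>
    obtain \<delta> where \<delta>: "\<delta> > 0" "\<And>h. 0 < h \<Longrightarrow> h < \<delta> \<Longrightarrow> \<psi> s < \<psi> (s + h)" by (auto simp: add_nonneg_pos)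
    define h where "h = min (\<delta> / 2) (y - s)"
    have h: "0 < h" "h < \<delta>" "s + h \<le> y" using \<delta>(1) \<open>s < y\<close> by (auto simp: h_def)
    have "s + h \<in> K" using \<delta>(2)[OF h(1,2)] h s \<open>\<psi> s = c\<close> by (auto simp: K_def)
    thus False using s(2) h by fastforce
  qed
  moreover have "\<epsilon> * (y - x) \<le> e"
    using \<open>e > 0\<close> xy by (simp add: \<epsilon>_def field_simps)
  ultimately show "\<phi> x \<le> \<phi> y + e" by (simp add: \<psi>_def algebra_simps)
qed

text \<open>
The quotient of the derivatives of \<open>Y\<close> and \<open>\<rho>\<close>. As \<open>\<rho>\<close> need not be injective near \<open>\<tau>\<close>, no inverse
function is differentiated: \<open>Y - \<rho> d\<close> has derivative \<open>0\<close> at \<open>\<tau>\<close>, while \<open>\<bar>\<rho> t - \<rho> \<tau>\<bar>\<close> is at least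
\<open>(w / 2) \<bar>t - \<tau>\<bar>\<close> near \<open>\<tau>\<close>, and by continuity \<open>\<rho>\<close> reaches every value close to \<open>\<rho> \<tau>\<close> at a
parameter close to \<open>\<tau>\<close>.
\<close>

lemma has_vector_derivative_change_clock:
  fixes \<rho> :: "real \<Rightarrow> real" and Y X :: "real \<Rightarrow> 'x::real_normed_vector"
  assumes cont: "continuous_on {a..b} \<rho>" and \<tau>: "\<tau> \<in> {a<..<b}"
    and d\<rho>: "(\<rho> has_real_derivative w) (at \<tau>)" and w: "w > 0"
    and dY: "(Y has_vector_derivative w *\<^sub>R d) (at \<tau>)"
    and X: "\<And>t. t \<in> {a..b} \<Longrightarrow> X (\<rho> t) = Y t"
  shows "(X has_vector_derivative d) (at (\<rho> \<tau>))"
  unfolding has_vector_derivative_def has_derivative_at_alt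
proof (intro conjI allI impI)
  show "bounded_linear (\<lambda>x. x *\<^sub>R d)" by (rule bounded_linear_scaleR_left)
  fix e :: real assume "e > 0"
  define D where "D t = Y t - \<rho> t *\<^sub>R d" for t
  have "((\<lambda>t. \<rho> t *\<^sub>R d) has_vector_derivative w *\<^sub>R d) (at \<tau>)"
    using d\<rho> bounded_linear.has_vector_derivative[OF bounded_linear_scaleR_left, of \<rho> w "at \<tau>" d]
    by (simp add: has_real_derivative_iff_has_vector_derivative)
  hence "(D has_vector_derivative 0) (at \<tau>)"
    unfolding D_def using has_vector_derivative_diff[OF dY] by fastforce
  moreover have "e * (w / 2) > 0" using \<open>e > 0\<close> w by simp
  ultimately obtain \<delta>1 where \<delta>1: "\<delta>1 > 0"
    "\<And>t. \<bar>t - \<tau>\<bar> < \<delta>1 \<Longrightarrow> norm (D t - D \<tau>) \<le> e * (w / 2) * \<bar>t - \<tau>\<bar>"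
    unfolding has_vector_derivative_def has_derivative_at_alt real_norm_def scaleR_zero_right diff_zero
    by meson
  have "w / 2 > 0" using w by simp
  then obtain \<delta>2 where \<delta>2: "\<delta>2 > 0"
    "\<And>t. \<bar>t - \<tau>\<bar> < \<delta>2 \<Longrightarrow> \<bar>\<rho> t - \<rho> \<tau> - w * (t - \<tau>)\<bar> \<le> w / 2 * \<bar>t - \<tau>\<bar>"
    using d\<rho> unfolding has_field_derivative_def has_derivative_at_alt real_norm_def by meson
  define \<delta> where "\<delta> = min (min \<delta>1 \<delta>2) (min (\<tau> - a) (b - \<tau>)) / 2"
  have \<delta>: "\<delta> > 0" "\<delta> < \<delta>1" "\<delta> < \<delta>2" "a \<le> \<tau> - \<delta>" "\<tau> + \<delta> \<le> b"
    using \<delta>1(1) \<delta>2(1) \<tau> by (auto simp: \<delta>_def min_def field_simps)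
  have "w * \<delta> > 0" using w \<delta> by simp
  have "\<bar>\<rho> (\<tau> + \<delta>) - \<rho> \<tau> - w * \<delta>\<bar> \<le> w * \<delta> / 2"
    using \<delta>2(2)[of "\<tau> + \<delta>"] \<delta> by simp
  hence R: "\<rho> (\<tau> + \<delta>) > \<rho> \<tau>" using \<open>w * \<delta> > 0\<close> unfolding abs_le_iff by linarith
  have "\<bar>\<rho> (\<tau> - \<delta>) - \<rho> \<tau> + w * \<delta>\<bar> \<le> w * \<delta> / 2"
    using \<delta>2(2)[of "\<tau> - \<delta>"] \<delta> by simp
  hence L: "\<rho> (\<tau> - \<delta>) < \<rho> \<tau>" using \<open>w * \<delta> > 0\<close> unfolding abs_le_iff by linarith
  define \<eta> where "\<eta> = min (\<rho> (\<tau> + \<delta>) - \<rho> \<tau>) (\<rho> \<tau> - \<rho> (\<tau> - \<delta>))"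
  show "\<exists>\<eta>>0. \<forall>y. norm (y - \<rho> \<tau>) < \<eta> \<longrightarrow>
          norm (X y - X (\<rho> \<tau>) - (y - \<rho> \<tau>) *\<^sub>R d) \<le> e * norm (y - \<rho> \<tau>)"
  proof (intro exI[of _ \<eta>] conjI allI impI)
    show "\<eta> > 0" using R L by (simp add: \<eta>_def)
    fix y assume "norm (y - \<rho> \<tau>) < \<eta>"
    hence "\<rho> (\<tau> - \<delta>) \<le> y" "y \<le> \<rho> (\<tau> + \<delta>)" by (auto simp: \<eta>_def)
    moreover have "continuous_on {\<tau> - \<delta>..\<tau> + \<delta>} \<rho>"
      by (rule continuous_on_subset[OF cont]) (use \<delta> in auto)
    ultimately obtain t where t: "\<tau> - \<delta> \<le> t" "t \<le> \<tau> + \<delta>" "\<rho> t = y"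
      using IVT'[of \<rho> "\<tau> - \<delta>" y "\<tau> + \<delta>"] \<delta> by auto
    have close: "\<bar>t - \<tau>\<bar> < \<delta>1" "\<bar>t - \<tau>\<bar> < \<delta>2" using t \<delta> by auto
    have "\<bar>w * (t - \<tau>)\<bar> = w * \<bar>t - \<tau>\<bar>" using w by (simp add: abs_mult)
    moreover have "\<bar>y - \<rho> \<tau> - w * (t - \<tau>)\<bar> \<le> w * \<bar>t - \<tau>\<bar> / 2"
      using \<delta>2(2)[OF close(2)] t(3) by simp
    ultimately have "w / 2 * \<bar>t - \<tau>\<bar> \<le> \<bar>y - \<rho> \<tau>\<bar>"
      by linarith
    hence "e * (w / 2 * \<bar>t - \<tau>\<bar>) \<le> e * \<bar>y - \<rho> \<tau>\<bar>"
      using \<open>e > 0\<close> by (intro mult_left_mono) auto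
    moreover have "X y - X (\<rho> \<tau>) - (y - \<rho> \<tau>) *\<^sub>R d = D t - D \<tau>"
      using X[of t] X[of \<tau>] t \<delta> \<tau> by (simp add: D_def algebra_simps)
    ultimately show "norm (X y - X (\<rho> \<tau>) - (y - \<rho> \<tau>) *\<^sub>R d) \<le> e * norm (y - \<rho> \<tau>)"
      using \<delta>1(2)[OF close(1)] by (simp add: mult.assoc)
  qed
qed

text \<open>
The hypothesis has the form in which the change-of-variables theorems are stated. It settles the
nonintegrable case as well, where both integrals take the default value \<open>0\<close>.
\<close>

lemma set_lebesgue_integral_eqI:
  fixes f :: "'x::euclidean_space \<Rightarrow> real" and g :: "'y::euclidean_space \<Rightarrow> real"
  assumes "\<And>c. f absolutely_integrable_on A \<and> integral A f = c \<longleftrightarrow>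
                g absolutely_integrable_on B \<and> integral B g = c"
  shows "(LINT x:A|lebesgue. f x) = (LINT y:B|lebesgue. g y)"
proof (cases "f absolutely_integrable_on A")
  case True
  thus ?thesis using assms[of "integral A f"] by (simp add: set_lebesgue_integral_eq_integral)
next
  case False
  hence "\<not> g absolutely_integrable_on B" using assms[of "integral B g"] by simp
  with False show ?thesis
    by (simp add: set_lebesgue_integral_def set_integrable_def not_integrable_integral_eq)
qed

section \<open>Essentially bounded controls\<close>

lemma L_inf_bounded_linear:
  assumes u: "L_inf I V u" and g: "bounded_linear g" and "g ` V \<subseteq> W"
  shows "L_inf I W (\<lambda>t. g (u t))"
proof -
  from u obtain B where B: "AE t in lebesgue_on I. norm (u t) \<le> B"
    and V: "AE t in lebesgue_on I. u t \<in> V" and meas: "u \<in> borel_measurable (lebesgue_on I)"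
    unfolding L_inf_def by blast
  obtain K where K: "K > 0" "\<And>x. norm (g x) \<le> norm x * K"
    using bounded_linear.pos_bounded[OF g] by blast
  have "AE t in lebesgue_on I. norm (g (u t)) \<le> B * K"
    using B by eventually_elim (use K in \<open>meson less_imp_le mult_right_mono order.trans\<close>)
  moreover have "AE t in lebesgue_on I. g (u t) \<in> W"
    using V by eventually_elim (use assms(3) in auto)
  moreover have "(\<lambda>t. g (u t)) \<in> borel_measurable (lebesgue_on I)"
    using meas by (rule measurable_compose)
      (intro borel_measurable_continuous_onI linear_continuous_on g)
  ultimately show ?thesis unfolding L_inf_def by blast
qed

lemma L_inf_Pair:
  assumes "L_inf I V u" "L_inf I W u'"
  shows "L_inf I (V \<times> W) (\<lambda>t. (u t, u' t))"
proof -
  from assms obtain B B' where B: "AE t in lebesgue_on I. norm (u t) \<le> B"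
      "AE t in lebesgue_on I. norm (u' t) \<le> B'"
    and V: "AE t in lebesgue_on I. u t \<in> V" "AE t in lebesgue_on I. u' t \<in> W"
    and meas: "u \<in> borel_measurable (lebesgue_on I)" "u' \<in> borel_measurable (lebesgue_on I)"
    unfolding L_inf_def by blast
  have "AE t in lebesgue_on I. norm (u t, u' t) \<le> B + B'"
    using B by eventually_elim (meson add_mono norm_Pair_le order.trans)
  moreover have "AE t in lebesgue_on I. (u t, u' t) \<in> V \<times> W"
    using V by eventually_elim simp
  moreover have "(\<lambda>t. (u t, u' t)) \<in> borel_measurable (lebesgue_on I)"
    using meas by (rule borel_measurable_Pair)
  ultimately show ?thesis unfolding L_inf_def by blast
qed

lemma L_inf_const: "c \<in> V \<Longrightarrow> L_inf I V (\<lambda>_. c)"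
  by (auto simp: L_inf_def)

lemma L_inf_Ioo_iff_Icc:
  fixes a b :: real and u :: "real \<Rightarrow> 'v::euclidean_space"
  shows "L_inf {a<..<b} V u \<longleftrightarrow> L_inf {a..b} V u"
proof -
  have AE: "(AE t in lebesgue_on {a<..<b}. Q t) \<longleftrightarrow> (AE t in lebesgue_on {a..b}. Q t)" for Q
  proof -
    have "negligible {t \<in> {a<..<b}. \<not> Q t} \<longleftrightarrow> negligible {t \<in> {a..b}. \<not> Q t}"
    proof
      assume "negligible {t \<in> {a<..<b}. \<not> Q t}"
      hence "negligible ({t \<in> {a<..<b}. \<not> Q t} \<union> {a, b})" by (simp add: negligible_Un)
      thus "negligible {t \<in> {a..b}. \<not> Q t}" by (rule negligible_subset) auto
    qed (rule negligible_subset, auto)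
    thus ?thesis by (simp only: AE_lebesgue_on_iff_negligible lmeasurable_interval[THEN fmeasurableD, unfolded box_real])
  qed
  have "u \<in> borel_measurable (lebesgue_on {a<..<b}) \<longleftrightarrow> u \<in> borel_measurable (lebesgue_on {a..b})"
  proof
    assume "u \<in> borel_measurable (lebesgue_on {a<..<b})"
    hence "(\<lambda>t. if t \<in> {a<..<b} then u t else 0) \<in> borel_measurable lebesgue"
      by (rule borel_measurable_if_I) simp
    moreover have "AE t in lebesgue. (if t \<in> {a<..<b} then u t else 0) = (if t \<in> {a..b} then u t else 0)"
    proof (rule AE_I')
      show "{a, b} \<in> null_sets lebesgue" by (simp add: negligible_iff_null_sets[symmetric])
    qed auto
    ultimately have "(\<lambda>t. if t \<in> {a..b} then u t else 0) \<in> borel_measurable lebesgue"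
      by (rule borel_measurable_AE)
    thus "u \<in> borel_measurable (lebesgue_on {a..b})"
      by (rule borel_measurable_if_D)
  qed (rule measurable_restrict_mono, auto)
  thus ?thesis unfolding L_inf_def AE by simp
qed

section \<open>Arcs with a clock\<close>

text \<open>
One regime of the duplicated problem, on its own: position \<open>Y\<close> and clock \<open>\<rho>\<close>, driven by the control
\<open>v\<close> and the clock speed \<open>w\<close>. The Lipschitz conditions are imposed on the closed interval, so that
the endpoint values of \<open>Y\<close> and \<open>\<rho>\<close> are their limits. For \<open>w = 1\<close> and \<open>\<rho> \<tau> = \<tau>\<close> this is a controlled arc.
\<close>

definition clocked_arc ::
  "('x::euclidean_space, 'a::euclidean_space) stratum \<Rightarrow> real \<Rightarrow> real \<Rightarrow> real \<Rightarrow>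
   (real \<Rightarrow> 'a) \<Rightarrow> (real \<Rightarrow> real) \<Rightarrow> (real \<Rightarrow> 'x) \<Rightarrow> (real \<Rightarrow> real) \<Rightarrow> bool"
where
  "clocked_arc P T a b v w Y \<rho> \<longleftrightarrow>
     L_inf {a<..<b} (controls P \<times> {0..T}) (\<lambda>\<tau>. (v \<tau>, w \<tau>)) \<and>
     (\<exists>L. L-lipschitz_on {a..b} Y) \<and> (\<exists>L. L-lipschitz_on {a..b} \<rho>) \<and>
     (\<forall>\<tau>\<in>{a<..<b}. Y \<tau> \<in> region P) \<and>
     (AE \<tau> in lebesgue_on {a<..<b}.
        (Y has_vector_derivative w \<tau> *\<^sub>R dyn P (Y \<tau>) (v \<tau>)) (at \<tau>) \<and>
        (\<rho> has_real_derivative w \<tau>) (at \<tau>))"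

text \<open>
Gathers all the almost-everywhere conditions into one measurable set \<open>G\<close> of full measure, on which
they hold without exception. Unlike almost-everywhere statements, this set can be mapped forward
by the clock.
\<close>

lemma clocked_arc_regular_points:
  assumes "clocked_arc P T a b v w Y \<rho>"
  obtains G B where "G \<subseteq> {a<..<b}" "negligible ({a<..<b} - G)" "G \<in> sets lebesgue"
    "\<And>\<tau>. \<tau> \<in> G \<Longrightarrow> v \<tau> \<in> controls P" "\<And>\<tau>. \<tau> \<in> G \<Longrightarrow> 0 \<le> w \<tau>" "\<And>\<tau>. \<tau> \<in> G \<Longrightarrow> w \<tau> \<le> T"
    "\<And>\<tau>. \<tau> \<in> G \<Longrightarrow> norm (v \<tau>) \<le> B"
    "\<And>\<tau>. \<tau> \<in> G \<Longrightarrow> (Y has_vector_derivative w \<tau> *\<^sub>R dyn P (Y \<tau>) (v \<tau>)) (at \<tau>)"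
    "\<And>\<tau>. \<tau> \<in> G \<Longrightarrow> (\<rho> has_real_derivative w \<tau>) (at \<tau>)"
proof -
  let ?I = "{a<..<b}"
  from assms obtain B where B: "AE \<tau> in lebesgue_on ?I. norm (v \<tau>, w \<tau>) \<le> B"
    and A: "AE \<tau> in lebesgue_on ?I. (v \<tau>, w \<tau>) \<in> controls P \<times> {0..T}"
    and D: "AE \<tau> in lebesgue_on ?I.
        (Y has_vector_derivative w \<tau> *\<^sub>R dyn P (Y \<tau>) (v \<tau>)) (at \<tau>) \<and>
        (\<rho> has_real_derivative w \<tau>) (at \<tau>)"
    unfolding clocked_arc_def L_inf_def by blast
  let ?Q = "\<lambda>\<tau>. norm (v \<tau>, w \<tau>) \<le> B \<and> (v \<tau>, w \<tau>) \<in> controls P \<times> {0..T} \<and>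
        (Y has_vector_derivative w \<tau> *\<^sub>R dyn P (Y \<tau>) (v \<tau>)) (at \<tau>) \<and>
        (\<rho> has_real_derivative w \<tau>) (at \<tau>)"
  define G where "G = {\<tau> \<in> ?I. ?Q \<tau>}"
  have "AE \<tau> in lebesgue_on ?I. ?Q \<tau>" using A B D by eventually_elim auto
  hence "negligible {\<tau> \<in> ?I. \<not> ?Q \<tau>}" by (subst (asm) AE_lebesgue_on_iff_negligible) auto
  also have "{\<tau> \<in> ?I. \<not> ?Q \<tau>} = ?I - G" by (auto simp: G_def)
  finally have neg: "negligible (?I - G)" .
  have "?I - (?I - G) \<in> sets lebesgue"
    using sets.Diff[OF lmeasurable_interval(2)[THEN fmeasurableD] negligible_imp_sets[OF neg]] by (simp only: box_real)
  moreover have "?I - (?I - G) = G" by (auto simp: G_def)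
  ultimately have Gleb: "G \<in> sets lebesgue" by (simp only:)
  show ?thesis
  proof (rule that[OF _ neg Gleb])
    show "G \<subseteq> ?I" by (auto simp: G_def)
    fix \<tau> assume "\<tau> \<in> G"
    hence Q: "?Q \<tau>" by (simp add: G_def)
    show "v \<tau> \<in> controls P" "0 \<le> w \<tau>" "w \<tau> \<le> T" using Q by auto
    show "norm (v \<tau>) \<le> B" using Q norm_fst_le[of "v \<tau>" "w \<tau>"] by linarith
    show "(Y has_vector_derivative w \<tau> *\<^sub>R dyn P (Y \<tau>) (v \<tau>)) (at \<tau>)"
      "(\<rho> has_real_derivative w \<tau>) (at \<tau>)" using Q by blast+
  qed
qed

text \<open>
The position moves only while the clock advances. The velocity is bounded by \<open>M w\<close>, so for
\<open>e = Y y - Y x\<close> the function \<open>norm e * M * \<rho> - e \<bullet> Y\<close> has nonnegative derivative almost everywhere; its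
monotonicity gives \<open>norm e * norm e \<le> norm e * M * (\<rho> y - \<rho> x)\<close>.
\<close>

lemma clocked_arc_increments:
  fixes P :: "('x::euclidean_space, 'a::euclidean_space) stratum"
  assumes arc: "clocked_arc P T a b v w Y \<rho>"
    and bdd: "bounded ((\<lambda>(x, c). dyn P x c) ` (region P \<times> controls P))"
  obtains M where "M \<ge> 0" "\<And>x y. a \<le> x \<Longrightarrow> x \<le> y \<Longrightarrow> y \<le> b \<Longrightarrow> \<rho> x \<le> \<rho> y"
    "\<And>x y. a \<le> x \<Longrightarrow> x \<le> y \<Longrightarrow> y \<le> b \<Longrightarrow> norm (Y y - Y x) \<le> M * (\<rho> y - \<rho> x)"
proof -
  let ?I = "{a<..<b}"
  from arc obtain L1 L2 where lipY: "L1-lipschitz_on {a..b} Y" and lip\<rho>: "L2-lipschitz_on {a..b} \<rho>"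
    and Yreg: "\<And>\<tau>. \<tau> \<in> ?I \<Longrightarrow> Y \<tau> \<in> region P"
    unfolding clocked_arc_def by blast
  obtain G B where G: "G \<subseteq> ?I" "negligible (?I - G)" "G \<in> sets lebesgue"
    "\<And>\<tau>. \<tau> \<in> G \<Longrightarrow> v \<tau> \<in> controls P" "\<And>\<tau>. \<tau> \<in> G \<Longrightarrow> 0 \<le> w \<tau>" "\<And>\<tau>. \<tau> \<in> G \<Longrightarrow> w \<tau> \<le> T"
    "\<And>\<tau>. \<tau> \<in> G \<Longrightarrow> norm (v \<tau>) \<le> B"
    "\<And>\<tau>. \<tau> \<in> G \<Longrightarrow> (Y has_vector_derivative w \<tau> *\<^sub>R dyn P (Y \<tau>) (v \<tau>)) (at \<tau>)"
    "\<And>\<tau>. \<tau> \<in> G \<Longrightarrow> (\<rho> has_real_derivative w \<tau>) (at \<tau>)"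
    by (rule clocked_arc_regular_points[OF arc]) (rule that, assumption+)
  obtain M where M: "\<And>x c. x \<in> region P \<Longrightarrow> c \<in> controls P \<Longrightarrow> norm (dyn P x c) \<le> M"
    using bdd unfolding bounded_iff by fastforce

  have mono: "\<rho> x \<le> \<rho> y" if "a \<le> x" "x \<le> y" "y \<le> b" for x y
  proof (rule lipschitz_AE_nonneg_deriv_mono[OF lip\<rho> G(2) _ that])
    fix \<tau> assume "\<tau> \<in> ?I - (?I - G)"
    hence "\<tau> \<in> G" by blast
    thus "\<exists>d\<ge>0. (\<rho> has_real_derivative d) (at \<tau>)" 
      using G(5)[of \<tau>] G(9)[of \<tau>] by (intro exI[of _ "w \<tau>"]) simp
  qed

  have incr: "norm (Y y - Y x) \<le> max 0 M * (\<rho> y - \<rho> x)"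
    if xy: "a \<le> x" "x \<le> y" "y \<le> b" for x y
  proof -
    define e where "e = Y y - Y x"
    define \<phi> where "\<phi> \<tau> = norm e * max 0 M * \<rho> \<tau> - e \<bullet> Y \<tau>" for \<tau>
    have "\<phi> x \<le> \<phi> y"
    proof (rule lipschitz_AE_nonneg_deriv_mono[OF _ G(2) _ xy])
      have "(\<bar>norm e * max 0 M\<bar> * L2 + norm e * L1)-lipschitz_on {a..b} \<phi>"
      proof (rule lipschitz_onI)
        fix s t assume st: "s \<in> {a..b}" "t \<in> {a..b}"
        have "\<phi> s - \<phi> t = norm e * max 0 M * (\<rho> s - \<rho> t) - e \<bullet> (Y s - Y t)"
          by (simp add: \<phi>_def algebra_simps)
        also have "\<bar>\<dots>\<bar> \<le> \<bar>norm e * max 0 M * (\<rho> s - \<rho> t)\<bar> + \<bar>e \<bullet> (Y s - Y t)\<bar>" by linarith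
        also have "\<dots> \<le> \<bar>norm e * max 0 M\<bar> * (L2 * dist s t) + norm e * (L1 * dist s t)"
          using lipschitz_onD[OF lip\<rho> st] lipschitz_onD[OF lipY st]
          by (intro add_mono order.trans[OF Cauchy_Schwarz_ineq2] mult_left_mono)
             (auto simp: abs_mult dist_norm intro!: mult_left_mono)
        finally show "dist (\<phi> s) (\<phi> t) \<le> (\<bar>norm e * max 0 M\<bar> * L2 + norm e * L1) * dist s t"
          by (simp add: dist_real_def algebra_simps)
      qed (use lipschitz_on_nonneg[OF lip\<rho>] lipschitz_on_nonneg[OF lipY] in auto)
      thus "(\<bar>norm e * max 0 M\<bar> * L2 + norm e * L1)-lipschitz_on {a..b} \<phi>" .
    next
      fix \<tau> assume "\<tau> \<in> ?I - (?I - G)"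
      hence \<tau>: "\<tau> \<in> G" "\<tau> \<in> ?I" using G(1) by auto
      let ?f = "dyn P (Y \<tau>) (v \<tau>)"
      have "((\<lambda>t. e \<bullet> Y t) has_real_derivative e \<bullet> (w \<tau> *\<^sub>R ?f)) (at \<tau>)"
        using bounded_linear.has_vector_derivative[OF bounded_linear_inner_right G(8)[OF \<tau>(1)]]
        by (simp add: has_real_derivative_iff_has_vector_derivative)
      hence "(\<phi> has_real_derivative norm e * max 0 M * w \<tau> - e \<bullet> (w \<tau> *\<^sub>R ?f)) (at \<tau>)"
        unfolding \<phi>_def by (intro DERIV_diff DERIV_cmult G \<tau>)
      moreover have "e \<bullet> (w \<tau> *\<^sub>R ?f) \<le> norm e * max 0 M * w \<tau>"
      proof -
        have "e \<bullet> ?f \<le> norm e * norm ?f" by (rule norm_cauchy_schwarz)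
        also have "\<dots> \<le> norm e * max 0 M"
          using M[OF Yreg[OF \<tau>(2)] G(4)[OF \<tau>(1)]] by (intro mult_left_mono) auto
        finally show ?thesis using G(5)[OF \<tau>(1)] by (simp add: mult_left_mono mult.commute)
      qed
      ultimately show "\<exists>d\<ge>0. (\<phi> has_real_derivative d) (at \<tau>)"
        by (intro exI[of _ "norm e * max 0 M * w \<tau> - e \<bullet> (w \<tau> *\<^sub>R ?f)"]) auto
    qed
    hence "e \<bullet> e \<le> norm e * (max 0 M * (\<rho> y - \<rho> x))"
      by (simp add: \<phi>_def e_def algebra_simps)
    hence "norm e * norm e \<le> norm e * (max 0 M * (\<rho> y - \<rho> x))"
      by (simp add: norm_eq_sqrt_inner)
    hence "norm e \<le> max 0 M * (\<rho> y - \<rho> x)" if "norm e > 0"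
      using that by (metis mult_le_cancel_left_pos)
    moreover have "0 \<le> max 0 M * (\<rho> y - \<rho> x)" using mono[OF xy] by simp
    ultimately show "norm (Y y - Y x) \<le> max 0 M * (\<rho> y - \<rho> x)"
      unfolding e_def[symmetric] by (cases "norm e > 0") auto
  qed
  show ?thesis by (rule that[OF _ mono incr]) (simp, assumption+)
qed

text \<open>
The time change \<open>s = \<rho> \<tau>\<close>, in which intervals where the clock stops collapse to points. Both the
position and the control at time \<open>s\<close> are read off at a parameter \<open>\<sigma> s\<close> where the clock shows \<open>s\<close>.
For the position the choice of \<open>\<sigma> s\<close> is immaterial by \<open>clocked_arc_increments\<close>; for the control it
matters, but almost every \<open>s\<close> is attained at a good parameter with \<open>w > 0\<close>, and no other parameter
then gives the same \<open>s\<close>.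
\<close>

lemma clocked_arc_unit_speed:
  fixes P :: "('x::euclidean_space, 'a::euclidean_space) stratum"
  assumes arc: "clocked_arc P T a b v w Y \<rho>"
    and bdd: "bounded ((\<lambda>(x, c). dyn P x c) ` (region P \<times> controls P))"
    and ab: "a < b" and ends: "\<rho> a < \<rho> b"
  obtains \<alpha> X where "controlled_arc P (\<rho> a) (\<rho> b) \<alpha> X" "X (\<rho> a) = Y a" "X (\<rho> b) = Y b"
    "arc_cost P (\<rho> a) (\<rho> b) \<alpha> X =
       (LINT \<tau>:{a<..<b}|lebesgue. running_cost P (Y \<tau>) (v \<tau>) * w \<tau>)"
proof -
  let ?I = "{a<..<b}" and ?J = "{\<rho> a<..<\<rho> b}"
  from arc obtain L1 L2 where lipY: "L1-lipschitz_on {a..b} Y" and lip\<rho>: "L2-lipschitz_on {a..b} \<rho>"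
    and Yreg: "\<And>\<tau>. \<tau> \<in> ?I \<Longrightarrow> Y \<tau> \<in> region P"
    and Linf: "L_inf ?I (controls P \<times> {0..T}) (\<lambda>\<tau>. (v \<tau>, w \<tau>))"
    unfolding clocked_arc_def by blast
  obtain G B where G: "G \<subseteq> ?I" "negligible (?I - G)" "G \<in> sets lebesgue"
    "\<And>\<tau>. \<tau> \<in> G \<Longrightarrow> v \<tau> \<in> controls P" "\<And>\<tau>. \<tau> \<in> G \<Longrightarrow> 0 \<le> w \<tau>" "\<And>\<tau>. \<tau> \<in> G \<Longrightarrow> w \<tau> \<le> T"
    "\<And>\<tau>. \<tau> \<in> G \<Longrightarrow> norm (v \<tau>) \<le> B"
    "\<And>\<tau>. \<tau> \<in> G \<Longrightarrow> (Y has_vector_derivative w \<tau> *\<^sub>R dyn P (Y \<tau>) (v \<tau>)) (at \<tau>)"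
    "\<And>\<tau>. \<tau> \<in> G \<Longrightarrow> (\<rho> has_real_derivative w \<tau>) (at \<tau>)"
    by (rule clocked_arc_regular_points[OF arc]) (rule that, assumption+)
  have measv: "v \<in> borel_measurable (lebesgue_on ?I)" and measw: "w \<in> borel_measurable (lebesgue_on ?I)"
    using L_inf_bounded_linear[OF Linf bounded_linear_fst, of "controls P"]
      L_inf_bounded_linear[OF Linf bounded_linear_snd, of "{0..T}"]
    by (auto simp: L_inf_def)
  obtain M' where M': "M' \<ge> 0"
    and mono: "\<And>x y. a \<le> x \<Longrightarrow> x \<le> y \<Longrightarrow> y \<le> b \<Longrightarrow> \<rho> x \<le> \<rho> y"
    and incr: "\<And>x y. a \<le> x \<Longrightarrow> x \<le> y \<Longrightarrow> y \<le> b \<Longrightarrow> norm (Y y - Y x) \<le> M' * (\<rho> y - \<rho> x)"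
    by (rule clocked_arc_increments[OF arc bdd]) (rule that, assumption+)
  have Ybound: "norm (Y y - Y x) \<le> M' * \<bar>\<rho> y - \<rho> x\<bar>" if "x \<in> {a..b}" "y \<in> {a..b}" for x y
    using incr[of x y] incr[of y x] mono[of x y] mono[of y x] that
    by (cases "x \<le> y") (auto simp: norm_minus_commute)

  have surj: "\<exists>\<tau>\<in>{a..b}. \<rho> \<tau> = s" if "s \<in> {\<rho> a..\<rho> b}" for s
    using IVT'[of \<rho> a s b] lipschitz_on_continuous_on[OF lip\<rho>] that ab by force
  define \<sigma> where "\<sigma> s = (SOME \<tau>. \<tau> \<in> {a..b} \<and> \<rho> \<tau> = s)" for s
  have \<sigma>: "\<sigma> s \<in> {a..b}" "\<rho> (\<sigma> s) = s" if "s \<in> {\<rho> a..\<rho> b}" for s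
    using someI_ex[of "\<lambda>\<tau>. \<tau> \<in> {a..b} \<and> \<rho> \<tau> = s"] surj[OF that] unfolding \<sigma>_def by blast+
  define X where "X s = Y (\<sigma> s)" for s
  have \<rho>range: "\<rho> \<tau> \<in> {\<rho> a..\<rho> b}" if "\<tau> \<in> {a..b}" for \<tau>
    using mono[of a \<tau>] mono[of \<tau> b] that by auto
  have X\<rho>: "X (\<rho> \<tau>) = Y \<tau>" if "\<tau> \<in> {a..b}" for \<tau>
    using Ybound[OF that \<sigma>(1)[OF \<rho>range[OF that]]] \<sigma>(2)[OF \<rho>range[OF that]] by (simp add: X_def)
  have lipX: "M'-lipschitz_on {\<rho> a..\<rho> b} X"
  proof (rule lipschitz_onI)
    fix s t assume st: "s \<in> {\<rho> a..\<rho> b}" "t \<in> {\<rho> a..\<rho> b}"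
    show "dist (X s) (X t) \<le> M' * dist s t"
      using Ybound[OF \<sigma>(1)[OF st(2)] \<sigma>(1)[OF st(1)]] \<sigma>(2)[OF st(1)] \<sigma>(2)[OF st(2)]
      by (simp add: X_def dist_norm)
  qed (rule M')
  have Xreg: "X s \<in> region P" if "s \<in> ?J" for s
  proof -
    have s: "s \<in> {\<rho> a..\<rho> b}" using that by auto
    have "\<sigma> s \<in> ?I" using \<sigma>[OF s] that by (cases "\<sigma> s = a"; cases "\<sigma> s = b") auto
    thus ?thesis using Yreg by (simp add: X_def)
  qed

  \<comment> \<open>On \<open>S\<close> the clock is injective, and it shows almost every time there.\<close>
  define S where "S = {\<tau> \<in> G. w \<tau> > 0}"
  have Sleb: "S \<in> sets lebesgue"
  proof -
    have "{\<tau> \<in> space (lebesgue_on ?I). 0 < w \<tau>} \<in> sets (lebesgue_on ?I)"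
      using measw by measurable
    hence "{\<tau> \<in> ?I. 0 < w \<tau>} \<in> sets lebesgue" by (simp add: sets_restrict_space_iff)
    moreover have "S = G \<inter> {\<tau> \<in> ?I. 0 < w \<tau>}" using G(1) by (auto simp: S_def)
    ultimately show ?thesis using G(3) by auto
  qed
  have SI: "S \<subseteq> ?I" and SG: "S \<subseteq> G" using G(1) by (auto simp: S_def)
  have S_D: "\<tau> \<in> G" "w \<tau> > 0" if "\<tau> \<in> S" for \<tau> using that by (auto simp: S_def)
  have strictR: "\<rho> \<tau> < \<rho> y" if \<tau>S: "\<tau> \<in> S" and "\<tau> < y" "y \<le> b" for \<tau> y
  proof -
    obtain \<delta> where \<delta>: "\<delta> > 0" "\<And>h. 0 < h \<Longrightarrow> h < \<delta> \<Longrightarrow> \<rho> \<tau> < \<rho> (\<tau> + h)"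
      using DERIV_pos_inc_right[OF G(9)] S_D[OF \<tau>S] by blast
    define h where "h = min (\<delta> / 2) (y - \<tau>)"
    have h: "0 < h" "h < \<delta>" "\<tau> + h \<le> y" using \<delta>(1) \<open>\<tau> < y\<close> by (auto simp: h_def)
    have "\<rho> \<tau> < \<rho> (\<tau> + h)" by (rule \<delta>(2)[OF h(1,2)])
    also have "\<dots> \<le> \<rho> y" using h \<tau>S \<open>y \<le> b\<close> SI by (intro mono) force+
    finally show ?thesis .
  qed
  have strictL: "\<rho> x < \<rho> \<tau>" if \<tau>S: "\<tau> \<in> S" and "a \<le> x" "x < \<tau>" for \<tau> x
  proof -
    obtain \<delta> where \<delta>: "\<delta> > 0" "\<And>h. 0 < h \<Longrightarrow> h < \<delta> \<Longrightarrow> \<rho> (\<tau> - h) < \<rho> \<tau>"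
      using DERIV_pos_inc_left[OF G(9)] S_D[OF \<tau>S] by blast
    define h where "h = min (\<delta> / 2) (\<tau> - x)"
    have h: "0 < h" "h < \<delta>" "x \<le> \<tau> - h" using \<delta>(1) \<open>x < \<tau>\<close> by (auto simp: h_def)
    have "\<rho> x \<le> \<rho> (\<tau> - h)" using h \<tau>S \<open>a \<le> x\<close> SI by (intro mono) force+
    also have "\<dots> < \<rho> \<tau>" by (rule \<delta>(2)[OF h(1,2)])
    finally show ?thesis .
  qed
  have S_unique: "\<tau>' = \<tau>" if "\<tau> \<in> S" "\<tau>' \<in> {a..b}" "\<rho> \<tau>' = \<rho> \<tau>" for \<tau> \<tau>'
  proof (rule ccontr)
    assume "\<tau>' \<noteq> \<tau>"
    then consider "\<tau>' < \<tau>" | "\<tau> < \<tau>'" by linarith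
    thus False
    proof cases
      case 1 thus False using strictL[OF that(1) _ 1] that(2,3) by simp
    next
      case 2 thus False using strictR[OF that(1) 2] that(2,3) by simp
    qed
  qed
  have S_ab: "\<tau> \<in> {a..b}" if "\<tau> \<in> S" for \<tau> using that SI by auto
  have inj: "inj_on \<rho> S"
    by (rule inj_onI) (rule S_unique[OF _ S_ab])
  have \<rho>SJ: "\<rho> ` S \<subseteq> ?J"
  proof
    fix s assume "s \<in> \<rho> ` S"
    then obtain \<tau> where \<tau>: "\<tau> \<in> S" "s = \<rho> \<tau>" by blast
    hence "a < \<tau>" "\<tau> < b" using SI by auto
    thus "s \<in> ?J" using strictL[OF \<tau>(1) order.refl] strictR[OF \<tau>(1) _ order.refl] \<tau>(2) by simp
  qed
  have \<sigma>S: "\<sigma> (\<rho> \<tau>) = \<tau>" if "\<tau> \<in> S" for \<tau>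
    by (rule S_unique[OF that]) (rule \<sigma>[OF \<rho>range[OF S_ab[OF that]]])+
  \<comment> \<open>A time not shown on \<open>S\<close> is shown on the null set of bad parameters or at a critical point of the clock.\<close>
  have neg: "negligible (?J - \<rho> ` S)"
  proof -
    have "negligible (\<rho> ` (?I - G))"
      by (rule lipschitz_on_negligible_image[OF lip\<rho> _ G(2)]) auto
    moreover have "negligible (\<rho> ` {\<tau> \<in> G. w \<tau> = 0})"
      by (rule sard_real) (use G(9) in force)
    ultimately have "negligible (\<rho> ` (?I - G) \<union> \<rho> ` {\<tau> \<in> G. w \<tau> = 0})"
      by (rule negligible_Un)
    moreover have "?J - \<rho> ` S \<subseteq> \<rho> ` (?I - G) \<union> \<rho> ` {\<tau> \<in> G. w \<tau> = 0}"
    proof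
      fix s assume s: "s \<in> ?J - \<rho> ` S"
      hence s': "s \<in> {\<rho> a..\<rho> b}" by auto
      have "\<sigma> s \<in> ?I" using \<sigma>[OF s'] s by (cases "\<sigma> s = a"; cases "\<sigma> s = b") auto
      moreover have "\<sigma> s \<notin> S" using s \<sigma>[OF s'] by force
      ultimately have "\<sigma> s \<in> (?I - G) \<union> {\<tau> \<in> G. w \<tau> = 0}"
        using G(5)[of "\<sigma> s"] by (auto simp: S_def)
      thus "s \<in> \<rho> ` (?I - G) \<union> \<rho> ` {\<tau> \<in> G. w \<tau> = 0}"
        using \<sigma>(2)[OF s'] by (metis (no_types, lifting) imageI image_Un)
    qed
    ultimately show ?thesis by (rule negligible_subset)
  qed

  have image_leb: "\<rho> ` U \<in> sets lebesgue" if "U \<subseteq> S" "U \<in> sets lebesgue" for U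
  proof (rule differentiable_image_in_sets_lebesgue[OF that(2)])
    show "\<rho> differentiable_on U"
      unfolding differentiable_on_def
    proof
      fix x assume "x \<in> U"
      hence "x \<in> G" using that(1) SG by blast
      thus "\<rho> differentiable (at x within U)"
        using has_field_derivative_at_within[OF G(9)] real_differentiable_def by blast
    qed
  qed auto

  \<comment> \<open>The value \<open>0\<close> is used on a null set of times only, where it need not be an admissible control.\<close>
  define \<alpha> where "\<alpha> s = (if s \<in> \<rho> ` S then v (\<sigma> s) else 0)" for s
  have \<alpha>\<rho>: "\<alpha> (\<rho> \<tau>) = v \<tau>" if "\<tau> \<in> S" for \<tau> using that \<sigma>S by (auto simp: \<alpha>_def)
  have \<alpha>meas: "\<alpha> \<in> borel_measurable (lebesgue_on ?J)"
  proof -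
    have "(\<lambda>s. v (\<sigma> s)) \<in> borel_measurable (lebesgue_on (\<rho> ` S))"
    proof (rule borel_measurableI)
      fix U :: "'a set" assume "open U"
      have "v -` U \<inter> space (lebesgue_on ?I) \<in> sets (lebesgue_on ?I)"
        using measv \<open>open U\<close> by (intro measurable_sets[OF measv]) auto
      hence "v -` U \<inter> ?I \<in> sets lebesgue" by (simp add: sets_restrict_space_iff)
      hence "S \<inter> (v -` U \<inter> ?I) \<in> sets lebesgue" using Sleb by blast
      hence "\<rho> ` (S \<inter> (v -` U \<inter> ?I)) \<in> sets lebesgue" by (intro image_leb) auto
      moreover have "(\<lambda>s. v (\<sigma> s)) -` U \<inter> space (lebesgue_on (\<rho> ` S)) = \<rho> ` (S \<inter> (v -` U \<inter> ?I))"
        using \<sigma>S SI by (auto simp: image_iff)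
      ultimately show "(\<lambda>s. v (\<sigma> s)) -` U \<inter> space (lebesgue_on (\<rho> ` S)) \<in> sets (lebesgue_on (\<rho> ` S))"
        using image_leb[OF order.refl Sleb] by (auto simp: sets_restrict_space_iff)
    qed
    hence "\<alpha> \<in> borel_measurable lebesgue"
      unfolding \<alpha>_def using image_leb[OF order.refl Sleb] by (intro borel_measurable_if_I)
    thus ?thesis by (rule measurable_restrict_space1)
  qed

  have ode: "(X has_vector_derivative dyn P (X (\<rho> \<tau>)) (\<alpha> (\<rho> \<tau>))) (at (\<rho> \<tau>))" if \<tau>: "\<tau> \<in> S" for \<tau>
  proof (rule has_vector_derivative_change_clock[OF lipschitz_on_continuous_on[OF lip\<rho>]])
    show "\<tau> \<in> ?I" "w \<tau> > 0" "(\<rho> has_real_derivative w \<tau>) (at \<tau>)"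
      using \<tau> SI G(9) by (auto simp: S_def)
    have "X (\<rho> \<tau>) = Y \<tau>" using \<tau> SI by (intro X\<rho>) auto
    thus "(Y has_vector_derivative w \<tau> *\<^sub>R dyn P (X (\<rho> \<tau>)) (\<alpha> (\<rho> \<tau>))) (at \<tau>)"
      using G(8)[of \<tau>] \<tau> SG \<alpha>\<rho>[OF \<tau>] by auto
  qed (rule X\<rho>)

  have ae: "AE s in lebesgue_on ?J. s \<in> \<rho> ` S"
    using neg by (subst AE_lebesgue_on_iff_negligible) (auto simp: set_diff_eq)
  have "controlled_arc P (\<rho> a) (\<rho> b) \<alpha> X"
    unfolding controlled_arc_def L_inf_def
  proof (intro conjI ballI)
    show "AE s in lebesgue_on ?J. \<alpha> s \<in> controls P"
      using ae by eventually_elim (auto simp: \<alpha>\<rho> intro: G(4)[OF S_D(1)])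
    show "\<exists>B. AE s in lebesgue_on ?J. norm (\<alpha> s) \<le> B"
      by (rule exI[of _ B], use ae in eventually_elim) (auto simp: \<alpha>\<rho> intro: G(7)[OF S_D(1)])
    show "AE s in lebesgue_on ?J. (X has_vector_derivative dyn P (X s) (\<alpha> s)) (at s)"
      using ae by eventually_elim (auto intro: ode)
  qed (use \<alpha>meas lipX Xreg in auto)
  moreover have "arc_cost P (\<rho> a) (\<rho> b) \<alpha> X =
       (LINT \<tau>:?I|lebesgue. running_cost P (Y \<tau>) (v \<tau>) * w \<tau>)"
    unfolding arc_cost_def
  proof (rule set_lebesgue_integral_eqI)
    fix c
    let ?f = "\<lambda>s. running_cost P (X s) (\<alpha> s)"
    let ?h = "\<lambda>\<tau>. running_cost P (Y \<tau>) (v \<tau>) * w \<tau>"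
    have "?f absolutely_integrable_on ?J \<longleftrightarrow> ?f absolutely_integrable_on \<rho> ` S"
      by (rule absolutely_integrable_spike_set_eq; rule negligible_subset[OF neg]) (use \<rho>SJ in auto)
    moreover have "integral (\<rho> ` S) ?f = integral ?J ?f"
      by (rule integral_subset_negligible[OF \<rho>SJ neg])
    moreover have "(\<lambda>\<tau>. \<bar>w \<tau>\<bar> * ?f (\<rho> \<tau>)) absolutely_integrable_on S \<and>
        integral S (\<lambda>\<tau>. \<bar>w \<tau>\<bar> * ?f (\<rho> \<tau>)) = c \<longleftrightarrow>
        ?f absolutely_integrable_on \<rho> ` S \<and> integral (\<rho> ` S) ?f = c"
      by (rule has_absolute_integral_change_of_variables_1'[OF Sleb _ inj])
         (use G(9) SG in \<open>auto intro: has_field_derivative_at_within\<close>)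
    moreover have eq: "\<bar>w \<tau>\<bar> * ?f (\<rho> \<tau>) = ?h \<tau>" if "\<tau> \<in> S" for \<tau>
      using that \<alpha>\<rho>[OF that] X\<rho>[of \<tau>] SI by (auto simp: S_def)
    have "(\<lambda>\<tau>. \<bar>w \<tau>\<bar> * ?f (\<rho> \<tau>)) absolutely_integrable_on S \<longleftrightarrow> ?h absolutely_integrable_on S"
      by (rule set_integrable_cong) (use eq in auto)
    moreover have "integral S (\<lambda>\<tau>. \<bar>w \<tau>\<bar> * ?f (\<rho> \<tau>)) = integral S ?h"
      using eq by (rule integral_cong)
    \<comment> \<open>The integrand \<open>?h\<close> vanishes where \<open>w = 0\<close>, so integrating over \<open>S\<close> or over the whole interval is the same.\<close>
    moreover have empty: "{\<tau> \<in> S - ?I. ?h \<tau> \<noteq> 0} = {}" using SI by blast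
    have off: "negligible {\<tau> \<in> ?I - S. ?h \<tau> \<noteq> 0}"
      by (rule negligible_subset[OF G(2)]) (use G(5) in \<open>force simp: S_def\<close>)
    have "?h absolutely_integrable_on S \<longleftrightarrow> ?h absolutely_integrable_on ?I"
      by (rule absolutely_integrable_spike_set_eq) (simp_all only: empty off negligible_empty)
    moreover have "integral S ?h = integral ?I ?h"
      by (rule integral_spike_set) (simp_all only: empty off negligible_empty)
    ultimately show "?f absolutely_integrable_on ?J \<and> integral ?J ?f = c \<longleftrightarrow>
        ?h absolutely_integrable_on ?I \<and> integral ?I ?h = c"
      by simp
  qed
  moreover have "X (\<rho> a) = Y a" "X (\<rho> b) = Y b" using X\<rho>[of a] X\<rho>[of b] ab by simp_all
  ultimately show ?thesis using that by blast
qed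

text \<open>
Integrability is what allows the cost of the duplicated problem to be split into its three
summands. The running cost is only continuous on the possibly non-Borel set
\<open>closure (region P) \<times> controls P\<close>, and composing it with Lebesgue measurable functions is safe because
they are regarded as maps into the subspace Borel algebra of that set.
\<close>

lemma clocked_arc_cost_integrable:
  fixes P :: "('x::euclidean_space, 'a::euclidean_space) stratum"
  assumes arc: "clocked_arc P T a b v w Y \<rho>"
    and cont: "continuous_on (closure (region P) \<times> controls P) (\<lambda>(x, c). running_cost P x c)"
    and bdd: "bounded ((\<lambda>(x, c). running_cost P x c) ` (region P \<times> controls P))"
  shows "(\<lambda>\<tau>. running_cost P (Y \<tau>) (v \<tau>) * w \<tau>) absolutely_integrable_on {a<..<b}"
proof -
  let ?I = "{a<..<b}" and ?h = "\<lambda>\<tau>. running_cost P (Y \<tau>) (v \<tau>) * w \<tau>"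
  from arc obtain L where lipY: "L-lipschitz_on {a..b} Y"
    and Yreg: "\<And>\<tau>. \<tau> \<in> ?I \<Longrightarrow> Y \<tau> \<in> region P"
    and Linf: "L_inf ?I (controls P \<times> {0..T}) (\<lambda>\<tau>. (v \<tau>, w \<tau>))"
    unfolding clocked_arc_def by blast
  obtain G B where G: "G \<subseteq> ?I" "negligible (?I - G)" "G \<in> sets lebesgue"
    "\<And>\<tau>. \<tau> \<in> G \<Longrightarrow> v \<tau> \<in> controls P" "\<And>\<tau>. \<tau> \<in> G \<Longrightarrow> 0 \<le> w \<tau>" "\<And>\<tau>. \<tau> \<in> G \<Longrightarrow> w \<tau> \<le> T"
    by (rule clocked_arc_regular_points[OF arc]) (rule that, assumption+)
  obtain K where K: "\<And>x c. x \<in> region P \<Longrightarrow> c \<in> controls P \<Longrightarrow> \<bar>running_cost P x c\<bar> \<le> K"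
    using bdd unfolding bounded_iff by fastforce
  have [measurable]: "v \<in> borel_measurable (lebesgue_on G)" "w \<in> borel_measurable (lebesgue_on G)"
    using L_inf_bounded_linear[OF Linf bounded_linear_fst subset_UNIV]
      L_inf_bounded_linear[OF Linf bounded_linear_snd subset_UNIV]
    unfolding L_inf_def fst_conv snd_conv by (blast intro: measurable_restrict_mono[OF _ G(1)])+
  have [measurable]: "Y \<in> borel_measurable (lebesgue_on G)"
    using continuous_imp_measurable_on_sets_lebesgue[OF continuous_on_subset[OF lipschitz_on_continuous_on[OF lipY]] G(3)]
      G(1) by force
  have "(\<lambda>\<tau>. (Y \<tau>, v \<tau>)) \<in> borel_measurable (lebesgue_on G)"
    by (rule borel_measurable_Pair) measurable
  hence "(\<lambda>\<tau>. (Y \<tau>, v \<tau>)) \<in> lebesgue_on G \<rightarrow>\<^sub>M restrict_space borel (closure (region P) \<times> controls P)"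
  proof (rule measurable_restrict_space2[rotated])
    show "(\<lambda>\<tau>. (Y \<tau>, v \<tau>)) \<in> space (lebesgue_on G) \<rightarrow> closure (region P) \<times> controls P"
      using subsetD[OF closure_subset Yreg[OF subsetD[OF G(1)]]] G(4) by simp
  qed
  from measurable_compose[OF this borel_measurable_continuous_on_restrict[OF cont]]
  have [measurable]: "(\<lambda>\<tau>. running_cost P (Y \<tau>) (v \<tau>)) \<in> borel_measurable (lebesgue_on G)" by simp
  have "G \<in> lmeasurable"
    by (rule lmeasurable_negligible_symdiff[of ?I]) (use G(1,2) in \<open>auto simp: Un_absorb2 Diff_eq_empty_iff[THEN iffD2]\<close>)
  hence "(\<lambda>\<tau>. K * T) integrable_on G" by (rule integrable_on_const)
  hence "?h absolutely_integrable_on G"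
  proof (rule measurable_bounded_by_integrable_imp_absolutely_integrable[rotated 2])
    show "norm (?h \<tau>) \<le> K * T" if "\<tau> \<in> G" for \<tau>
    proof -
      have "\<bar>running_cost P (Y \<tau>) (v \<tau>)\<bar> * \<bar>w \<tau>\<bar> \<le> K * T"
        using K[of "Y \<tau>" "v \<tau>"] Yreg[of \<tau>] G(1) G(4-6)[OF that] that by (intro mult_mono) auto
      thus ?thesis by (simp add: abs_mult)
    qed
  qed (use G(3) in measurable)
  also have "?h absolutely_integrable_on G \<longleftrightarrow> ?h absolutely_integrable_on ?I"
    by (rule absolutely_integrable_spike_set_eq; rule negligible_subset[OF G(2)]) (use G(1) in auto)
  finally show ?thesis .
qed

section \<open>Arcs run at constant speed\<close>

text \<open>
Multiplying dynamics and cost by \<open>c\<close> turns the given arc into one whose clock \<open>(s - s0) / c\<close> has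
speed \<open>1 / c\<close>; the unit-speed arc obtained from it for the scaled regime is, for the original
regime, an arc of speed \<open>c\<close>.
\<close>

lemma controlled_arc_constant_speed:
  fixes P :: "('x::euclidean_space, 'a::euclidean_space) stratum"
  assumes arc: "controlled_arc P s0 s1 \<alpha> X" and s: "s0 < s1" and K: "K > 0"
    and bdd: "bounded ((\<lambda>(x, c). dyn P x c) ` (region P \<times> controls P))"
    and c: "c = (s1 - s0) / K" "c \<le> T"
  obtains v Y where "clocked_arc P T 0 K v (\<lambda>_. c) Y (\<lambda>\<tau>. s0 + c * \<tau>)" "Y 0 = X s0" "Y K = X s1"
    "(LINT \<tau>:{0<..<K}|lebesgue. running_cost P (Y \<tau>) (v \<tau>) * c) = arc_cost P s0 s1 \<alpha> X"
proof -
  have c_pos: "c > 0" using s K c by simp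
  define Q where "Q = P\<lparr>dyn := \<lambda>x a. c *\<^sub>R dyn P x a, running_cost := \<lambda>x a. running_cost P x a * c\<rparr>"
  have Q: "region Q = region P" "controls Q = controls P" "dyn Q = (\<lambda>x a. c *\<^sub>R dyn P x a)"
    "running_cost Q = (\<lambda>x a. running_cost P x a * c)" by (simp_all add: Q_def)
  define \<rho> where "\<rho> s = (s - s0) / c" for s
  have \<rho>ends: "\<rho> s0 = 0" "\<rho> s1 = K" using K s c by (simp_all add: \<rho>_def)
  have "clocked_arc Q (1 / c) s0 s1 \<alpha> (\<lambda>_. 1 / c) X \<rho>"
    unfolding clocked_arc_def
  proof (intro conjI)
    have "L_inf {s0<..<s1} (controls Q) \<alpha>" using arc by (simp add: controlled_arc_def Q)
    thus "L_inf {s0<..<s1} (controls Q \<times> {0..1 / c}) (\<lambda>\<tau>. (\<alpha> \<tau>, 1 / c))"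
      using c_pos by (intro L_inf_Pair L_inf_const) auto
    show "\<exists>L. L-lipschitz_on {s0..s1} X" "\<forall>\<tau>\<in>{s0<..<s1}. X \<tau> \<in> region Q"
      using arc by (auto simp: controlled_arc_def Q)
    have "(1 / c)-lipschitz_on {s0..s1} \<rho>"
      using c_pos by (intro lipschitz_onI) (auto simp: \<rho>_def dist_real_def abs_divide simp flip: diff_divide_distrib)
    thus "\<exists>L. L-lipschitz_on {s0..s1} \<rho>" by blast
    have "AE \<tau> in lebesgue_on {s0<..<s1}. (X has_vector_derivative dyn P (X \<tau>) (\<alpha> \<tau>)) (at \<tau>)"
      using arc by (simp add: controlled_arc_def)
    moreover have "(\<rho> has_real_derivative 1 / c) (at \<tau>)" for \<tau>
      unfolding \<rho>_def using c_pos by (auto intro!: derivative_eq_intros)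
    ultimately show "AE \<tau> in lebesgue_on {s0<..<s1}.
        (X has_vector_derivative (1 / c) *\<^sub>R dyn Q (X \<tau>) (\<alpha> \<tau>)) (at \<tau>) \<and>
        (\<rho> has_real_derivative 1 / c) (at \<tau>)"
      using c_pos by (auto simp: Q elim: eventually_mono)
  qed
  moreover have "bounded ((\<lambda>(x, a). dyn Q x a) ` (region Q \<times> controls Q))"
    using bounded_scaling[OF bdd, of c] by (simp add: Q image_image case_prod_unfold)
  ultimately obtain v Y where vY: "controlled_arc Q (\<rho> s0) (\<rho> s1) v Y" "Y (\<rho> s0) = X s0" "Y (\<rho> s1) = X s1"
    "arc_cost Q (\<rho> s0) (\<rho> s1) v Y =
       (LINT \<tau>:{s0<..<s1}|lebesgue. running_cost Q (X \<tau>) (\<alpha> \<tau>) * (1 / c))"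
    using s K \<rho>ends by (auto elim!: clocked_arc_unit_speed)
  note vY = vY[unfolded \<rho>ends]
  have "clocked_arc P T 0 K v (\<lambda>_. c) Y (\<lambda>\<tau>. s0 + c * \<tau>)"
    unfolding clocked_arc_def
  proof (intro conjI)
    have "L_inf {0<..<K} (controls P) v" using vY(1) by (simp add: controlled_arc_def Q)
    thus "L_inf {0<..<K} (controls P \<times> {0..T}) (\<lambda>\<tau>. (v \<tau>, c))"
      using c_pos c by (intro L_inf_Pair L_inf_const) auto
    show "\<exists>L. L-lipschitz_on {0..K} Y" "\<forall>\<tau>\<in>{0<..<K}. Y \<tau> \<in> region P"
      using vY(1) by (auto simp: controlled_arc_def Q)
    have "c-lipschitz_on {0..K} (\<lambda>\<tau>. s0 + c * \<tau>)"
      using c_pos by (intro lipschitz_onI) (auto simp: dist_real_def abs_mult simp flip: right_diff_distrib)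
    thus "\<exists>L. L-lipschitz_on {0..K} (\<lambda>\<tau>. s0 + c * \<tau>)" by blast
    have "((\<lambda>\<tau>. s0 + c * \<tau>) has_real_derivative c) (at \<tau>)" for \<tau>
      by (auto intro!: derivative_eq_intros)
    thus "AE \<tau> in lebesgue_on {0<..<K}. (Y has_vector_derivative c *\<^sub>R dyn P (Y \<tau>) (v \<tau>)) (at \<tau>) \<and>
        ((\<lambda>\<tau>. s0 + c * \<tau>) has_real_derivative c) (at \<tau>)"
      using vY(1) by (simp add: controlled_arc_def Q)
  qed
  moreover have "(LINT \<tau>:{0<..<K}|lebesgue. running_cost P (Y \<tau>) (v \<tau>) * c) = arc_cost P s0 s1 \<alpha> X"
    using vY(4) c_pos by (simp add: arc_cost_def Q)
  ultimately show ?thesis using that vY(2,3) by blast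
qed

section \<open>Trajectories of the duplicated problem as triples of arcs with clocks\<close>

lemma dup_dyn_proj:
  "dup_dyn P1 PH P2 z u =
     (snd (fst u) *\<^sub>R dyn P1 (fst z) (fst (fst u)), snd (fst u),
      snd (fst (snd u)) *\<^sub>R dyn PH (fst (snd (snd z))) (fst (fst (snd u))), snd (fst (snd u)),
      snd (snd (snd u)) *\<^sub>R dyn P2 (fst (snd (snd (snd (snd z))))) (fst (snd (snd u))), snd (snd (snd u)))"
  by (cases z; cases u) auto

lemma dup_running_cost_proj:
  "dup_running_cost P1 PH P2 z u =
     running_cost P1 (fst z) (fst (fst u)) * snd (fst u) +
     running_cost PH (fst (snd (snd z))) (fst (fst (snd u))) * snd (fst (snd u)) +
     running_cost P2 (fst (snd (snd (snd (snd z))))) (fst (snd (snd u))) * snd (snd (snd u))"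
  by (cases z; cases u) auto

text \<open>
Uniform treatment of the three copies: \<open>p\<close> selects the control and clock speed of one copy, \<open>q\<close> its
position and \<open>r\<close> its clock.
\<close>

lemma clocked_arc_projection:
  fixes P :: "('x::euclidean_space, 'a::euclidean_space) stratum"
    and W :: "real \<Rightarrow> 'z::euclidean_space" and u :: "real \<Rightarrow> 'v::euclidean_space"
  assumes u: "L_inf {a<..<b} V u" and W: "L-lipschitz_on {a..b} W"
    and lin: "bounded_linear p" "bounded_linear q" "bounded_linear r"
    and p: "p ` V \<subseteq> controls P \<times> {0..T}"
    and q: "\<And>\<tau>. \<tau> \<in> {a<..<b} \<Longrightarrow> q (W \<tau>) \<in> region P"
    and D: "AE \<tau> in lebesgue_on {a<..<b}. (W has_vector_derivative D \<tau>) (at \<tau>)"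
    and qD: "\<And>\<tau>. q (D \<tau>) = snd (p (u \<tau>)) *\<^sub>R dyn P (q (W \<tau>)) (fst (p (u \<tau>)))"
    and rD: "\<And>\<tau>. r (D \<tau>) = snd (p (u \<tau>))"
  shows "clocked_arc P T a b (\<lambda>\<tau>. fst (p (u \<tau>))) (\<lambda>\<tau>. snd (p (u \<tau>))) (\<lambda>\<tau>. q (W \<tau>)) (\<lambda>\<tau>. r (W \<tau>))"
  unfolding clocked_arc_def
proof (intro conjI ballI)
  show "L_inf {a<..<b} (controls P \<times> {0..T}) (\<lambda>\<tau>. (fst (p (u \<tau>)), snd (p (u \<tau>))))"
    using L_inf_bounded_linear[OF u lin(1) p] by simp
  have lip: "\<exists>L. L-lipschitz_on {a..b} (\<lambda>\<tau>. g (W \<tau>))" if g: "bounded_linear g" for g :: "'z \<Rightarrow> 'y::real_normed_vector"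
  proof -
    obtain C where "C-lipschitz_on (W ` {a..b}) g" by (rule bounded_linear.lipschitz_boundE[OF g])
    from lipschitz_on_compose2[OF W this] show ?thesis by blast
  qed
  show "\<exists>L. L-lipschitz_on {a..b} (\<lambda>\<tau>. q (W \<tau>))" "\<exists>L. L-lipschitz_on {a..b} (\<lambda>\<tau>. r (W \<tau>))"
    by (intro lip lin)+
  show "AE \<tau> in lebesgue_on {a<..<b}.
      ((\<lambda>\<tau>. q (W \<tau>)) has_vector_derivative snd (p (u \<tau>)) *\<^sub>R dyn P (q (W \<tau>)) (fst (p (u \<tau>)))) (at \<tau>) \<and>
      ((\<lambda>\<tau>. r (W \<tau>)) has_real_derivative snd (p (u \<tau>))) (at \<tau>)"
    using D
  proof eventually_elim
    case (elim \<tau>)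
    show ?case
      using bounded_linear.has_vector_derivative[OF lin(2) elim] bounded_linear.has_vector_derivative[OF lin(3) elim]
      unfolding qD rD has_real_derivative_iff_has_vector_derivative by blast
  qed
qed (rule q)

lemma lipschitz_extension_to_endpoints:
  fixes Z :: "real \<Rightarrow> 'z::metric_space"
  assumes "a < b" "L-lipschitz_on {a<..<b} Z"
    and "(Z \<longlongrightarrow> z0) (at_right a)" "(Z \<longlongrightarrow> z1) (at_left b)"
  obtains W where "L-lipschitz_on {a..b} W" "W a = z0" "W b = z1" "\<And>t. t \<in> {a<..<b} \<Longrightarrow> W t = Z t"
proof
  define W where "W t = (if t = a then z0 else if t = b then z1 else Z t)" for t
  show WZ: "W t = Z t" if "t \<in> {a<..<b}" for t using that by (auto simp: W_def)
  show "W a = z0" "W b = z1" using assms(1) by (auto simp: W_def)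
  have "L-lipschitz_on {a<..<b} W"
    using assms(2) by (rule lipschitz_on_transform) (simp add: WZ)
  moreover have "continuous_on {a..b} W"
  proof (rule continuous_on_IccI[OF _ _ _ assms(1)])
    have ev: "eventually (\<lambda>t. t \<in> {a<..<b}) (at_right a)" "eventually (\<lambda>t. t \<in> {a<..<b}) (at_left b)"
      using eventually_at_right_real[OF assms(1)] eventually_at_left_real[OF assms(1)] by auto
    show "(W \<longlongrightarrow> W a) (at_right a)"
      unfolding \<open>W a = z0\<close>
      by (rule Lim_transform_eventually[OF assms(3)]) (rule eventually_mono[OF ev(1)], simp add: WZ)
    show "(W \<longlongrightarrow> W b) (at_left b)"
      unfolding \<open>W b = z1\<close>
      by (rule Lim_transform_eventually[OF assms(4)]) (rule eventually_mono[OF ev(2)], simp add: WZ)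
    show "W \<midarrow>x\<rightarrow> W x" if "a < x" "x < b" for x
    proof -
      have "continuous_on {a<..<b} W" using calculation by (rule lipschitz_on_continuous_on)
      thus ?thesis using that by (simp add: continuous_on_eq_continuous_at isCont_def)
    qed
  qed
  ultimately show "L-lipschitz_on {a..b} W"
    using lipschitz_on_closure[of L "{a<..<b}" W] assms(1) by simp
qed

text \<open>
The trajectory is only prescribed on the open interval; it is first replaced by its continuous
extension, which changes neither the almost-everywhere conditions nor the cost.
\<close>

lemma dup_admissible_imp_clocked_arcs:
  fixes P1 PH P2 :: "('x::euclidean_space, 'a::euclidean_space) stratum"
  assumes adm: "dup_admissible P1 PH P2 T (y1, r1, yH, rH, y2, r2) T0 (y1', r1', yH', rH', y2', r2') T1 u Z"
    and less: "T0 < T1"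
  obtains v1 w1 Y1 \<rho>1 vH wH YH \<rho>H v2 w2 Y2 \<rho>2 where
    "clocked_arc P1 T T0 T1 v1 w1 Y1 \<rho>1" "Y1 T0 = y1" "\<rho>1 T0 = r1" "Y1 T1 = y1'" "\<rho>1 T1 = r1'"
    "clocked_arc PH T T0 T1 vH wH YH \<rho>H" "YH T0 = yH" "\<rho>H T0 = rH" "YH T1 = yH'" "\<rho>H T1 = rH'"
    "clocked_arc P2 T T0 T1 v2 w2 Y2 \<rho>2" "Y2 T0 = y2" "\<rho>2 T0 = r2" "Y2 T1 = y2'" "\<rho>2 T1 = r2'"
    "dup_cost P1 PH P2 T0 T1 u Z = (LINT \<tau>:{T0<..<T1}|lebesgue.
       running_cost P1 (Y1 \<tau>) (v1 \<tau>) * w1 \<tau> + running_cost PH (YH \<tau>) (vH \<tau>) * wH \<tau> +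
       running_cost P2 (Y2 \<tau>) (v2 \<tau>) * w2 \<tau>)"
proof -
  let ?I = "{T0<..<T1}"
  from adm obtain L where lipZ: "L-lipschitz_on ?I Z"
    and u: "L_inf {T0..T1} (dup_controls P1 PH P2 T) u"
    and states: "\<And>\<tau>. \<tau> \<in> ?I \<Longrightarrow> Z \<tau> \<in> dup_states P1 PH P2"
    and der: "AE \<tau> in lebesgue_on ?I. (Z has_vector_derivative dup_dyn P1 PH P2 (Z \<tau>) (u \<tau>)) (at \<tau>)"
    and lim: "(Z \<longlongrightarrow> (y1, r1, yH, rH, y2, r2)) (at_right T0)"
      "(Z \<longlongrightarrow> (y1', r1', yH', rH', y2', r2')) (at_left T1)"
    unfolding dup_admissible_def by blast
  obtain W where W: "L-lipschitz_on {T0..T1} W" "W T0 = (y1, r1, yH, rH, y2, r2)"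
    "W T1 = (y1', r1', yH', rH', y2', r2')" "\<And>\<tau>. \<tau> \<in> ?I \<Longrightarrow> W \<tau> = Z \<tau>"
    using lipschitz_extension_to_endpoints[OF less lipZ lim] by blast
  note u' = u[folded L_inf_Ioo_iff_Icc]
  have "AE \<tau> in lebesgue_on ?I. \<tau> \<in> ?I" by (rule AE_I2) (simp add: space_restrict_space)
  hence derW: "AE \<tau> in lebesgue_on ?I. (W has_vector_derivative dup_dyn P1 PH P2 (W \<tau>) (u \<tau>)) (at \<tau>)"
    using der
  proof eventually_elim
    case (elim \<tau>)
    show ?case unfolding W(4)[OF elim(1)]
      by (rule has_vector_derivative_transform_within_open[OF elim(2) _ elim(1)]) (auto simp: W(4))
  qed
  note arc = clocked_arc_projection[OF u' W(1), where D = "\<lambda>\<tau>. dup_dyn P1 PH P2 (W \<tau>) (u \<tau>)", OF _ _ _ _ _ derW]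
  note bl = bounded_linear_compose[OF bounded_linear_fst] bounded_linear_compose[OF bounded_linear_snd]
    bounded_linear_fst bounded_linear_snd
  have 1: "clocked_arc P1 T T0 T1 (\<lambda>\<tau>. fst (fst (u \<tau>))) (\<lambda>\<tau>. snd (fst (u \<tau>)))
      (\<lambda>\<tau>. fst (W \<tau>)) (\<lambda>\<tau>. fst (snd (W \<tau>)))"
    by (rule arc[of fst fst "\<lambda>z. fst (snd z)"])
       (use states W(4) in \<open>force simp: dup_dyn_proj dup_controls_def dup_states_def intro!: bl\<close>)+
  have 2: "clocked_arc PH T T0 T1 (\<lambda>\<tau>. fst (fst (snd (u \<tau>)))) (\<lambda>\<tau>. snd (fst (snd (u \<tau>))))
      (\<lambda>\<tau>. fst (snd (snd (W \<tau>)))) (\<lambda>\<tau>. fst (snd (snd (snd (W \<tau>)))))"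
    by (rule arc[of "\<lambda>z. fst (snd z)" "\<lambda>z. fst (snd (snd z))" "\<lambda>z. fst (snd (snd (snd z)))"])
       (use states W(4) in \<open>force simp: dup_dyn_proj dup_controls_def dup_states_def intro!: bl\<close>)+
  have 3: "clocked_arc P2 T T0 T1 (\<lambda>\<tau>. fst (snd (snd (u \<tau>)))) (\<lambda>\<tau>. snd (snd (snd (u \<tau>))))
      (\<lambda>\<tau>. fst (snd (snd (snd (snd (W \<tau>)))))) (\<lambda>\<tau>. snd (snd (snd (snd (snd (W \<tau>))))))"
    by (rule arc[of "\<lambda>z. snd (snd z)" "\<lambda>z. fst (snd (snd (snd (snd z))))" "\<lambda>z. snd (snd (snd (snd (snd z))))"])
       (use states W(4) in \<open>force simp: dup_dyn_proj dup_controls_def dup_states_def intro!: bl\<close>)+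
  have "dup_cost P1 PH P2 T0 T1 u Z = (LINT \<tau>:?I|lebesgue. dup_running_cost P1 PH P2 (W \<tau>) (u \<tau>))"
    unfolding dup_cost_def by (rule set_lebesgue_integral_cong) (auto simp: W(4))
  thus ?thesis
    by (intro that[OF 1 _ _ _ _ 2 _ _ _ _ 3]) (simp_all only: W(2,3) fst_conv snd_conv dup_running_cost_proj)
qed

lemma clocked_arcs_imp_dup_admissible:
  fixes P1 PH P2 :: "('x::euclidean_space, 'a::euclidean_space) stratum"
  assumes arcs: "clocked_arc P1 T T0 T1 v1 w1 Y1 \<rho>1" "clocked_arc PH T T0 T1 vH wH YH \<rho>H"
      "clocked_arc P2 T T0 T1 v2 w2 Y2 \<rho>2"
    and pos: "\<And>\<tau>. \<tau> \<in> {T0<..<T1} \<Longrightarrow> \<rho>1 \<tau> > 0 \<and> \<rho>H \<tau> > 0 \<and> \<rho>2 \<tau> > 0"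
    and less: "T0 < T1"
  shows "dup_admissible P1 PH P2 T (Y1 T0, \<rho>1 T0, YH T0, \<rho>H T0, Y2 T0, \<rho>2 T0) T0
           (Y1 T1, \<rho>1 T1, YH T1, \<rho>H T1, Y2 T1, \<rho>2 T1) T1
           (\<lambda>\<tau>. ((v1 \<tau>, w1 \<tau>), (vH \<tau>, wH \<tau>), (v2 \<tau>, w2 \<tau>)))
           (\<lambda>\<tau>. (Y1 \<tau>, \<rho>1 \<tau>, YH \<tau>, \<rho>H \<tau>, Y2 \<tau>, \<rho>2 \<tau>))"
proof -
  have Linf: "L_inf {T0<..<T1} (controls P1 \<times> {0..T}) (\<lambda>\<tau>. (v1 \<tau>, w1 \<tau>))"
    "L_inf {T0<..<T1} (controls PH \<times> {0..T}) (\<lambda>\<tau>. (vH \<tau>, wH \<tau>))"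
    "L_inf {T0<..<T1} (controls P2 \<times> {0..T}) (\<lambda>\<tau>. (v2 \<tau>, w2 \<tau>))"
    using arcs unfolding clocked_arc_def by blast+
  let ?Z = "\<lambda>\<tau>. (Y1 \<tau>, \<rho>1 \<tau>, YH \<tau>, \<rho>H \<tau>, Y2 \<tau>, \<rho>2 \<tau>)"
  have "\<exists>L. L-lipschitz_on {T0..T1} ?Z"
  proof -
    have pair: "\<exists>L. L-lipschitz_on {T0..T1} (\<lambda>\<tau>. (f \<tau>, g \<tau>))"
      if "\<exists>L. L-lipschitz_on {T0..T1} f" "\<exists>L. L-lipschitz_on {T0..T1} g"
      for f :: "real \<Rightarrow> 'y::metric_space" and g :: "real \<Rightarrow> 'z::metric_space"
      using that lipschitz_on_Pair by blast
    show ?thesis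
      using arcs unfolding clocked_arc_def by (intro pair) blast+
  qed
  then obtain L where L: "L-lipschitz_on {T0..T1} ?Z" by blast
  have cont: "continuous_on {T0..T1} ?Z" by (rule lipschitz_on_continuous_on[OF L])
  show ?thesis
    unfolding dup_admissible_def
  proof (intro conjI ballI)
    show "L_inf {T0..T1} (dup_controls P1 PH P2 T) (\<lambda>\<tau>. ((v1 \<tau>, w1 \<tau>), (vH \<tau>, wH \<tau>), (v2 \<tau>, w2 \<tau>)))"
      unfolding dup_controls_def L_inf_Ioo_iff_Icc[symmetric]
      by (rule L_inf_Pair[OF Linf(1) L_inf_Pair[OF Linf(2,3)]])
    show "\<exists>L. L-lipschitz_on {T0<..<T1} ?Z"
      by (rule exI[of _ L]) (rule lipschitz_on_subset[OF L], auto)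
    show "?Z \<tau> \<in> dup_states P1 PH P2" if "\<tau> \<in> {T0<..<T1}" for \<tau>
      using arcs pos[OF that] that by (auto simp: clocked_arc_def dup_states_def)
    have "AE \<tau> in lebesgue_on {T0<..<T1}.
        (Y1 has_vector_derivative w1 \<tau> *\<^sub>R dyn P1 (Y1 \<tau>) (v1 \<tau>)) (at \<tau>) \<and>
        (\<rho>1 has_real_derivative w1 \<tau>) (at \<tau>)" "AE \<tau> in lebesgue_on {T0<..<T1}.
        (YH has_vector_derivative wH \<tau> *\<^sub>R dyn PH (YH \<tau>) (vH \<tau>)) (at \<tau>) \<and>
        (\<rho>H has_real_derivative wH \<tau>) (at \<tau>)" "AE \<tau> in lebesgue_on {T0<..<T1}.
        (Y2 has_vector_derivative w2 \<tau> *\<^sub>R dyn P2 (Y2 \<tau>) (v2 \<tau>)) (at \<tau>) \<and>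
        (\<rho>2 has_real_derivative w2 \<tau>) (at \<tau>)"
      using arcs unfolding clocked_arc_def by blast+
    thus "AE \<tau> in lebesgue_on {T0<..<T1}. (?Z has_vector_derivative dup_dyn P1 PH P2 (?Z \<tau>)
        ((v1 \<tau>, w1 \<tau>), (vH \<tau>, wH \<tau>), (v2 \<tau>, w2 \<tau>))) (at \<tau>)"
      by eventually_elim
        (simp add: has_real_derivative_iff_has_vector_derivative has_vector_derivative_Pair)
    show "(?Z \<longlongrightarrow> (Y1 T0, \<rho>1 T0, YH T0, \<rho>H T0, Y2 T0, \<rho>2 T0)) (at_right T0)"
      by (rule continuous_on_Icc_at_rightD[OF cont less])
    show "(?Z \<longlongrightarrow> (Y1 T1, \<rho>1 T1, YH T1, \<rho>H T1, Y2 T1, \<rho>2 T1)) (at_left T1)"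
      by (rule continuous_on_Icc_at_leftD[OF cont less])
  qed
qed

lemma clocked_arcs_cost_sum:
  fixes P1 PH P2 :: "('x::euclidean_space, 'a::euclidean_space) stratum"
  assumes reg: "regular_stratum P1" "regular_stratum PH" "regular_stratum P2"
    and arcs: "clocked_arc P1 T T0 T1 v1 w1 Y1 \<rho>1" "clocked_arc PH T T0 T1 vH wH YH \<rho>H"
      "clocked_arc P2 T T0 T1 v2 w2 Y2 \<rho>2"
  shows "(LINT \<tau>:{T0<..<T1}|lebesgue.
       running_cost P1 (Y1 \<tau>) (v1 \<tau>) * w1 \<tau> + running_cost PH (YH \<tau>) (vH \<tau>) * wH \<tau> +
       running_cost P2 (Y2 \<tau>) (v2 \<tau>) * w2 \<tau>) =
     (LINT \<tau>:{T0<..<T1}|lebesgue. running_cost P1 (Y1 \<tau>) (v1 \<tau>) * w1 \<tau>) +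
     (LINT \<tau>:{T0<..<T1}|lebesgue. running_cost PH (YH \<tau>) (vH \<tau>) * wH \<tau>) +
     (LINT \<tau>:{T0<..<T1}|lebesgue. running_cost P2 (Y2 \<tau>) (v2 \<tau>) * w2 \<tau>)"
proof -
  have int: "(\<lambda>\<tau>. running_cost P (Y \<tau>) (v \<tau>) * w \<tau>) absolutely_integrable_on {T0<..<T1}"
    if "regular_stratum P" "clocked_arc P T T0 T1 v w Y \<rho>"
    for P :: "('x, 'a) stratum" and v w Y \<rho>
    using that clocked_arc_cost_integrable unfolding regular_stratum_def regular_in_state_def by blast
  note i = int[OF reg(1) arcs(1)] int[OF reg(2) arcs(2)] int[OF reg(3) arcs(3)]
  show ?thesis
    by (simp only: set_integral_add(2)[OF set_integral_add(1)[OF i(1,2)] i(3)] set_integral_add(2)[OF i(1,2)])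
qed

section \<open>Comparison of the two value functions\<close>

text \<open>
The three clocks run through \<open>[t0, t1]\<close>, \<open>[t1, t2]\<close> and \<open>[t2, tf]\<close> by the definition of the junction
set, so the unit-speed versions of the three arcs fit together to one regional trajectory.
\<close>

lemma S_1H2_le_dup_cost:
  fixes P1 PH P2 :: "('x::euclidean_space, 'a::euclidean_space) stratum"
  assumes reg: "regular_stratum P1" "regular_stratum PH" "regular_stratum P2"
    and J: "(Z0, Z1) \<in> junctions (region PH) x0 t0 xf tf"
    and adm: "dup_admissible P1 PH P2 T Z0 T0 Z1 T1 u Z" and less: "T0 < T1"
  shows "S_1H2 P1 PH P2 x0 t0 xf tf \<le> ereal (dup_cost P1 PH P2 T0 T1 u Z)"
proof -
  from J obtain x1 t1 x2 t2 where x: "x1 \<in> region PH" "x2 \<in> region PH" "t0 < t1" "t1 < t2" "t2 < tf"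
    and Z: "Z0 = (x0, t0, x1, t1, x2, t2)" "Z1 = (x1, t1, x2, t2, xf, tf)"
    unfolding junctions_def by blast
  obtain v1 w1 Y1 \<rho>1 vH wH YH \<rho>H v2 w2 Y2 \<rho>2 where
    a1: "clocked_arc P1 T T0 T1 v1 w1 Y1 \<rho>1" and e1: "Y1 T0 = x0" "\<rho>1 T0 = t0" "Y1 T1 = x1" "\<rho>1 T1 = t1" and
    aH: "clocked_arc PH T T0 T1 vH wH YH \<rho>H" and eH: "YH T0 = x1" "\<rho>H T0 = t1" "YH T1 = x2" "\<rho>H T1 = t2" and
    a2: "clocked_arc P2 T T0 T1 v2 w2 Y2 \<rho>2" and e2: "Y2 T0 = x2" "\<rho>2 T0 = t2" "Y2 T1 = xf" "\<rho>2 T1 = tf" and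
    cost: "dup_cost P1 PH P2 T0 T1 u Z = (LINT \<tau>:{T0<..<T1}|lebesgue.
       running_cost P1 (Y1 \<tau>) (v1 \<tau>) * w1 \<tau> + running_cost PH (YH \<tau>) (vH \<tau>) * wH \<tau> +
       running_cost P2 (Y2 \<tau>) (v2 \<tau>) * w2 \<tau>)"
    by (rule dup_admissible_imp_clocked_arcs[OF adm[unfolded Z] less]) (rule that, assumption+)
  have bdd: "bounded ((\<lambda>(x, c). dyn P x c) ` (region P \<times> controls P))" if "regular_stratum P"
    for P :: "('x, 'a) stratum"
    using that by (simp add: regular_stratum_def regular_in_state_def)
  obtain \<alpha>1 X1 where A1: "controlled_arc P1 t0 t1 \<alpha>1 X1" "X1 t0 = x0" "X1 t1 = x1"
    "arc_cost P1 t0 t1 \<alpha>1 X1 = (LINT \<tau>:{T0<..<T1}|lebesgue. running_cost P1 (Y1 \<tau>) (v1 \<tau>) * w1 \<tau>)"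
    using clocked_arc_unit_speed[OF a1 bdd[OF reg(1)] less] x(3) unfolding e1 by blast
  obtain \<alpha>H XH where AH: "controlled_arc PH t1 t2 \<alpha>H XH" "XH t1 = x1" "XH t2 = x2"
    "arc_cost PH t1 t2 \<alpha>H XH = (LINT \<tau>:{T0<..<T1}|lebesgue. running_cost PH (YH \<tau>) (vH \<tau>) * wH \<tau>)"
    using clocked_arc_unit_speed[OF aH bdd[OF reg(2)] less] x(4) unfolding eH by blast
  obtain \<alpha>2 X2 where A2: "controlled_arc P2 t2 tf \<alpha>2 X2" "X2 t2 = x2" "X2 tf = xf"
    "arc_cost P2 t2 tf \<alpha>2 X2 = (LINT \<tau>:{T0<..<T1}|lebesgue. running_cost P2 (Y2 \<tau>) (v2 \<tau>) * w2 \<tau>)"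
    using clocked_arc_unit_speed[OF a2 bdd[OF reg(3)] less] x(5) unfolding e2 by blast
  have "admissible P1 PH P2 x0 t0 xf tf t1 t2 \<alpha>1 \<alpha>H \<alpha>2 X1 XH X2"
    using A1 AH A2 x by (simp add: admissible_def)
  moreover have "dup_cost P1 PH P2 T0 T1 u Z = trajectory_cost P1 PH P2 t0 tf t1 t2 \<alpha>1 \<alpha>H \<alpha>2 X1 XH X2"
    unfolding cost trajectory_cost_def A1(4) AH(4) A2(4) by (rule clocked_arcs_cost_sum[OF reg a1 aH a2])
  ultimately show ?thesis unfolding S_1H2_def by (intro Inf_lower) blast
qed

text \<open>
The junction points and times are those of the given trajectory. Each of the time spans is at most
\<open>tf - t0 = T K\<close>, hence can be covered during \<open>[0, K]\<close> at a constant speed of at most \<open>T\<close>.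
\<close>

lemma \<Sigma>_dup_le_trajectory_cost:
  fixes P1 PH P2 :: "('x::euclidean_space, 'a::euclidean_space) stratum"
  assumes reg: "regular_stratum P1" "regular_stratum PH" "regular_stratum P2"
    and adm: "admissible P1 PH P2 x0 t0 xf tf t1 t2 \<alpha>1 \<alpha>H \<alpha>2 X1 XH X2"
    and pos: "t0 > 0" "T > 0"
  shows "\<exists>Z0 Z1 K. (Z0, Z1) \<in> junctions (region PH) x0 t0 xf tf \<and> 0 < K \<and>
    \<Sigma>_dup P1 PH P2 T Z0 0 Z1 K \<le> ereal (trajectory_cost P1 PH P2 t0 tf t1 t2 \<alpha>1 \<alpha>H \<alpha>2 X1 XH X2)"
proof -
  from adm have t: "t0 < t1" "t1 < t2" "t2 < tf"
    and arcs: "controlled_arc P1 t0 t1 \<alpha>1 X1" "controlled_arc PH t1 t2 \<alpha>H XH" "controlled_arc P2 t2 tf \<alpha>2 X2"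
    and ends: "X1 t0 = x0" "X1 t1 = XH t1" "XH t1 \<in> region PH" "XH t2 = X2 t2" "X2 t2 \<in> region PH" "X2 tf = xf"
    unfolding admissible_def by blast+
  define K where "K = (tf - t0) / T"
  have K: "K > 0" using t pos by (simp add: K_def)
  have speed: "(b - a) / K \<le> T" if "t0 \<le> a" "b \<le> tf" for a b
  proof -
    have "T * K = tf - t0" using pos by (simp add: K_def)
    thus ?thesis using that by (simp add: pos_divide_le_eq[OF K])
  qed
  have bdd: "bounded ((\<lambda>(x, c). dyn P x c) ` (region P \<times> controls P))" if "regular_stratum P"
    for P :: "('x, 'a) stratum"
    using that by (simp add: regular_stratum_def regular_in_state_def)
  define c1 cH c2 where c: "c1 = (t1 - t0) / K" "cH = (t2 - t1) / K" "c2 = (tf - t2) / K"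
  have c_pos: "c1 > 0" "cH > 0" "c2 > 0" using t K by (simp_all add: c)
  have cT: "c1 \<le> T" "cH \<le> T" "c2 \<le> T" unfolding c using t by (intro speed; simp)+
  obtain v1 Y1 where A1: "clocked_arc P1 T 0 K v1 (\<lambda>_. c1) Y1 (\<lambda>\<tau>. t0 + c1 * \<tau>)" "Y1 0 = X1 t0" "Y1 K = X1 t1"
    "(LINT \<tau>:{0<..<K}|lebesgue. running_cost P1 (Y1 \<tau>) (v1 \<tau>) * c1) = arc_cost P1 t0 t1 \<alpha>1 X1"
    using controlled_arc_constant_speed[OF arcs(1) t(1) K bdd[OF reg(1)] c(1) cT(1)] by blast
  obtain vH YH where AH: "clocked_arc PH T 0 K vH (\<lambda>_. cH) YH (\<lambda>\<tau>. t1 + cH * \<tau>)" "YH 0 = XH t1" "YH K = XH t2"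
    "(LINT \<tau>:{0<..<K}|lebesgue. running_cost PH (YH \<tau>) (vH \<tau>) * cH) = arc_cost PH t1 t2 \<alpha>H XH"
    using controlled_arc_constant_speed[OF arcs(2) t(2) K bdd[OF reg(2)] c(2) cT(2)] by blast
  obtain v2 Y2 where A2: "clocked_arc P2 T 0 K v2 (\<lambda>_. c2) Y2 (\<lambda>\<tau>. t2 + c2 * \<tau>)" "Y2 0 = X2 t2" "Y2 K = X2 tf"
    "(LINT \<tau>:{0<..<K}|lebesgue. running_cost P2 (Y2 \<tau>) (v2 \<tau>) * c2) = arc_cost P2 t2 tf \<alpha>2 X2"
    using controlled_arc_constant_speed[OF arcs(3) t(3) K bdd[OF reg(3)] c(3) cT(3)] by blast
  have cK: "t0 + c1 * K = t1" "t1 + cH * K = t2" "t2 + c2 * K = tf" using K by (simp_all add: c)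
  let ?Z0 = "(x0, t0, XH t1, t1, XH t2, t2)" and ?Z1 = "(XH t1, t1, XH t2, t2, xf, tf)"
  define u where "u = (\<lambda>\<tau>. ((v1 \<tau>, c1), (vH \<tau>, cH), (v2 \<tau>, c2)))"
  define Z where "Z = (\<lambda>\<tau>. (Y1 \<tau>, t0 + c1 * \<tau>, YH \<tau>, t1 + cH * \<tau>, Y2 \<tau>, t2 + c2 * \<tau>))"
  have "dup_admissible P1 PH P2 T ?Z0 0 ?Z1 K u Z"
    using clocked_arcs_imp_dup_admissible[OF A1(1) AH(1) A2(1) _ K] c_pos pos t
    unfolding u_def Z_def A1(2,3) AH(2,3) A2(2,3) ends cK mult_zero_right add_0_right
    by (simp add: add_pos_pos ends)
  hence "\<Sigma>_dup P1 PH P2 T ?Z0 0 ?Z1 K \<le> ereal (dup_cost P1 PH P2 0 K u Z)"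
    unfolding \<Sigma>_dup_def by (intro Inf_lower) blast
  also have "dup_cost P1 PH P2 0 K u Z = trajectory_cost P1 PH P2 t0 tf t1 t2 \<alpha>1 \<alpha>H \<alpha>2 X1 XH X2"
    unfolding dup_cost_def trajectory_cost_def u_def Z_def dup_running_cost.simps
      A1(4)[symmetric] AH(4)[symmetric] A2(4)[symmetric]
    by (rule clocked_arcs_cost_sum[OF reg A1(1) AH(1) A2(1)])
  finally have "\<Sigma>_dup P1 PH P2 T ?Z0 0 ?Z1 K \<le> \<dots>" .
  moreover have "(?Z0, ?Z1) \<in> junctions (region PH) x0 t0 xf tf"
    using ends t unfolding junctions_def by auto
  ultimately show ?thesis using K by blast
qed

theorem proposition2p2:
  fixes P1 PH P2 :: "(real ^ 'n, real ^ 'm) stratum"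
    and \<Psi> :: "real ^ 'n \<Rightarrow> real"
    and grad\<Psi> :: "real ^ 'n \<Rightarrow> real ^ 'n"
    and x0 xf :: "real ^ 'n"
    and t0 tf T :: real
  assumes "standing_assumptions P1 PH P2 \<Psi> grad\<Psi>"
    and "T > 0"
    and "x0 \<in> region P1" and "t0 > 0" and "xf \<in> region P2" and "tf > 0"
    and "\<exists>t1 t2 \<alpha>1 aH \<alpha>2 X1 XH X2. optimal P1 PH P2 x0 t0 xf tf t1 t2 \<alpha>1 aH \<alpha>2 X1 XH X2"
  shows "is_minimum_of (S_1H2 P1 PH P2 x0 t0 xf tf)
           {\<Sigma>_dup P1 PH P2 T Z0 T0 Z1 T1 | Z0 Z1 T0 T1.
              (Z0, Z1) \<in> junctions (region PH) x0 t0 xf tf \<and> 0 \<le> T0 \<and> T0 < T1}"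
proof -
  let ?S = "S_1H2 P1 PH P2 x0 t0 xf tf"
  have reg: "regular_stratum P1" "regular_stratum PH" "regular_stratum P2"
    using assms(1) by (simp_all add: standing_assumptions_def)
  have lower: "?S \<le> \<Sigma>_dup P1 PH P2 T Z0 T0 Z1 T1"
    if "(Z0, Z1) \<in> junctions (region PH) x0 t0 xf tf" "T0 < T1" for Z0 Z1 T0 T1
    unfolding \<Sigma>_dup_def using S_1H2_le_dup_cost[OF reg that(1) _ that(2)] by (intro Inf_greatest) blast
  from assms(7) obtain t1 t2 \<alpha>1 aH \<alpha>2 X1 XH X2
    where opt: "optimal P1 PH P2 x0 t0 xf tf t1 t2 \<alpha>1 aH \<alpha>2 X1 XH X2" by blast
  obtain Z0 Z1 K where J: "(Z0, Z1) \<in> junctions (region PH) x0 t0 xf tf" "0 < K"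
    and le: "\<Sigma>_dup P1 PH P2 T Z0 0 Z1 K \<le> ?S"
    using \<Sigma>_dup_le_trajectory_cost[OF reg _ assms(4,2)] opt unfolding optimal_def by metis
  have "?S = \<Sigma>_dup P1 PH P2 T Z0 0 Z1 K"
    using le lower[OF J] by (rule antisym[rotated])
  thus ?thesis
    unfolding is_minimum_of_def using J lower by blast
qed

end
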